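(* Assume the mismatched problem (P) and the standing assumption (SA) described in the context. Let $\gamma\in\Gamma$, let $z_0\in\mathcal{H}$, and let $(z_n)_{n\in\mathbb{N}}$ and $(x_n)_{n\in\mathbb{N}}$ be generated by, for every $n\in\mathbb{N}$, $$x_n=J_{\gamma C}z_n,\quad w_n=D_{K_n}x_n,\quad y_n=J_{\gamma A}(2x_n-z_n-\gamma w_n),\quad z_{n+1}=z_n+y_n-x_n-\gamma(D_{K_n}y_n-w_n).$$ Then the following hold. (i) $(z_n)_{n\in\mathbb{N}}$ converges weakly to some $\overline{z}\in\mathrm{Fix}\,V^\gamma$ and $(x_n)_{n\in\mathbb{N}}$ converges weakly to $J_{\gamma C}\overline{z}\in\mathrm{zer}(A+C+D_K)$. (ii) If $\hat\rho>0$ and there exists $\overline{\eta}\in[0,1[$ such that, for every $n\in\mathbb{N}$, $\omega_n=\omega_0\,\overline{\eta}^n$, then $(z_n)_{n\in\mathbb{N}}$ converges linearly to $\overline{z}\in\mathrm{Fix}\,V^\gamma$ and $(x_n)_{n\in\mathbb{N}}$ converges linearly to $J_{\gamma C}\overline{z}$, which is the unique solution to (P).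
   Context: $\mathcal{H}$ and $\mathcal{G}$ are real Hilbert spaces; $\mathcal{B}(\mathcal{G},\mathcal{H})$ is the set of bounded linear operators from $\mathcal{G}$ to $\mathcal{H}$. For $\rho\in\mathbb{R}$, $A:\mathcal{H}\to2^{\mathcal{H}}$ is $\rho$-monotone if $\langle x-y\mid u-v\rangle\ge\rho\|x-y\|^2$ for all $(x,u),(y,v)$ in the graph of $A$, and maximally $\rho$-monotone if moreover its graph is maximal for inclusion among graphs of $\rho$-monotone operators. $C:\mathcal{H}\to\mathcal{H}$ is $\beta$-cocoercive if $\langle x-y\mid Cx-Cy\rangle\ge\beta\|Cx-Cy\|^2$ for all $x,y$. $\operatorname{Lip}T$ is the smallest Lipschitz constant of $T$. $\mathrm{zer}\,A=\{x:0\in Ax\}$ and $\mathrm{Fix}\,T=\{x:Tx=x\}$. The resolvent is $J_A=(\mathrm{Id}+A)^{-1}$; it is single valued when $A$ is maximally $\rho$-monotone with $\rho>-1$. Problem (P): $A:\mathcal{H}\to2^{\mathcal{H}}$ is maximally $\rho$-monotone for some $\rho\in\mathbb{R}$, $C:\mathcal{H}\to\mathcal{H}$ is $\beta$-cocoercive for some $\beta\in\left]0,+\infty\right[$, $B:\mathcal{G}\to\mathcal{G}$ is monotone and $\zeta$-Lipschitzian for some $\zeta\in\left]0,+\infty\right[$, $L:\mathcal{H}\to\mathcal{G}$ and $K:\mathcal{G}\to\mathcal{H}$ are bounded linear operators, $c\in\mathcal{G}$, $\alpha\in[0,+\infty[$. Find $x\in\mathcal{H}$ such that $0\in Ax+Cx+\alpha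 K(Lx-c)+KBLx$, under the assumption that the set of solutions is nonempty. Notation: for $M\in\mathcal{B}(\mathcal{G},\mathcal{H})$, $D_M:x\mapsto\alpha M(Lx-c)+MBLx$, $\kappa_M=\operatorname{Lip}(M(\alpha\,\mathrm{Id}_{\mathcal{G}}+B)L)$, $\widetilde\zeta_M=\operatorname{Lip}(MBL)$; $\lambda_{\min}=\inf\{\langle x\mid KLx\rangle : x\in\mathcal{H},\ \|x\|=1\}$; $\hat\rho=\rho+\alpha\lambda_{\min}-\widetilde\zeta_{L^*-K}$. Standing assumption (SA): $D_K\neq0$; $\hat\rho\ge0$; $(K_n)_{n\in\mathbb{N}}$ is a sequence in $\mathcal{B}(\mathcal{G},\mathcal{H})$ such that $\|K_n-K\|\le\omega_n$ for every $n\in\mathbb{N}$, where $\{\omega_n\}_{n\in\mathbb{N}}\subset[0,+\infty[$ and $\sum_{n}\omega_n<+\infty$. Further notation: $\Gamma=\left\{\gamma\in\left]0,+\infty\right[ : \kappa_K^2\gamma^2\left(1+\frac{\gamma}{2\beta}\right)<1\ \text{and}\ \rho\gamma>-1\right\}$. For $\gamma\in\Gamma$, $R^\gamma=J_{\gamma A}(2J_{\gamma C}-\mathrm{Id}_{\mathcal{H}}-\gamma D_KJ_{\gamma C})$ and $V^\gamma=(\mathrm{Id}_{\mathcal{H}}-\gamma D_K)R^\gamma+\mathrm{Id}_{\mathcal{H}}-(\mathrm{Id}_{\mathcal{H}}-\gamma D_K)J_{\gamma C}$ (juxtaposition denotes composition). A sequence $(z_n)$ converges linearly to $z$ if there exist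 $R\ge0$ and $r\in\left]0,1\right[$ such that $\|z_n-z\|\le R\,r^n$ for all $n$ (large enough). *)

theory Defs
  imports "HOL-Analysis.Analysis"
begin

text \<open>
  A real Hilbert space is a type of sort \<open>{real_inner, complete_space}\<close>.  Set-valued operators
  are functions \<open>'h \<Rightarrow> 'h set\<close>; sums of sets are Minkowski sums, and a single-valued operator \<open>T\<close>
  is seen as the set-valued operator \<open>single T\<close>.
\<close>

subsection \<open>Set-valued operators\<close>

definition single :: "('h \<Rightarrow> 'h) \<Rightarrow> 'h \<Rightarrow> 'h set" where
  "single T = (\<lambda>x. {T x})"

definition scale_op :: "real \<Rightarrow> ('h::real_vector \<Rightarrow> 'h set) \<Rightarrow> 'h \<Rightarrow> 'h set" where
  "scale_op \<gamma> A = (\<lambda>x. (\<lambda>u. \<gamma> *\<^sub>R u) ` A x)"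

definition gra :: "('h \<Rightarrow> 'h set) \<Rightarrow> ('h \<times> 'h) set" where
  "gra A = {(x, u). u \<in> A x}"

definition zer :: "('h::zero \<Rightarrow> 'h set) \<Rightarrow> 'h set" where
  "zer A = {x. 0 \<in> A x}"

definition Fix :: "('h \<Rightarrow> 'h) \<Rightarrow> 'h set" where
  "Fix T = {x. T x = x}"

definition inverse_op :: "('h \<Rightarrow> 'h set) \<Rightarrow> 'h \<Rightarrow> 'h set" where
  "inverse_op A = (\<lambda>u. {x. u \<in> A x})"

text \<open>
  \<open>(Id + A)\<^sup>-\<^sup>1\<close> read as a function.  It is meaningful only where \<open>(Id + A)\<^sup>-\<^sup>1\<close> takes singleton
  values, which is everywhere if \<open>A\<close> is maximally \<open>\<rho>\<close>-monotone with \<open>\<rho> > -1\<close>.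
\<close>
definition resolvent :: "('h::real_vector \<Rightarrow> 'h set) \<Rightarrow> 'h \<Rightarrow> 'h" where
  "resolvent A = (\<lambda>u. the_elem (inverse_op (\<lambda>x. {x} + A x) u))"

definition rho_monotone :: "real \<Rightarrow> ('h::real_inner \<Rightarrow> 'h set) \<Rightarrow> bool" where
  "rho_monotone \<rho> A \<longleftrightarrow>
     (\<forall>(x, u) \<in> gra A. \<forall>(y, v) \<in> gra A. inner (x - y) (u - v) \<ge> \<rho> * (norm (x - y))\<^sup>2)"

definition max_rho_monotone :: "real \<Rightarrow> ('h::real_inner \<Rightarrow> 'h set) \<Rightarrow> bool" where
  "max_rho_monotone \<rho> A \<longleftrightarrow>
     rho_monotone \<rho> A \<and> (\<forall>A'. rho_monotone \<rho> A' \<and> gra A \<subseteq> gra A' \<longrightarrow> gra A' = gra A)"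

definition cocoercive :: "real \<Rightarrow> ('h::real_inner \<Rightarrow> 'h) \<Rightarrow> bool" where
  "cocoercive \<beta> C \<longleftrightarrow> (\<forall>x y. inner (x - y) (C x - C y) \<ge> \<beta> * (norm (C x - C y))\<^sup>2)"


subsection \<open>Smallest Lipschitz constant\<close>

definition Lip :: "('a::metric_space \<Rightarrow> 'b::metric_space) \<Rightarrow> real" where
  "Lip T = Inf {l. l-lipschitz_on UNIV T}"

lemma Lip_le:
  assumes "l-lipschitz_on UNIV T"
  shows "Lip T \<le> l"
  unfolding Lip_def using assms
  by (intro cInf_lower bdd_belowI[of _ 0]) (auto dest: lipschitz_on_nonneg)

lemma Lip_lipschitz:
  assumes "l-lipschitz_on UNIV T"
  shows "(Lip T)-lipschitz_on UNIV T"
proof (rule lipschitz_onI)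
  have ne: "{l. l-lipschitz_on UNIV T} \<noteq> {}"
    using assms by blast
  show nonneg: "0 \<le> Lip T"
    unfolding Lip_def using ne by (intro cInf_greatest) (auto dest: lipschitz_on_nonneg)
  show "dist (T x) (T y) \<le> Lip T * dist x y" for x y
  proof (cases "x = y")
    case False
    have "dist (T x) (T y) / dist x y \<le> Lip T"
      unfolding Lip_def using ne
    proof (rule cInf_greatest)
      fix l assume "l \<in> {l. l-lipschitz_on UNIV T}"
      then have "dist (T x) (T y) \<le> l * dist x y"
        by (auto dest: lipschitz_onD)
      then show "dist (T x) (T y) / dist x y \<le> l"
        using False by (simp add: divide_simps)
    qed
    then show ?thesis
      using False by (simp add: divide_simps)
  qed simp
qed


subsection \<open>Adjoint of a bounded operator between Hilbert spaces\<close>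

definition hilbert_adjoint ::
  "('h::{real_inner, complete_space} \<Rightarrow>\<^sub>L 'g::{real_inner, complete_space}) \<Rightarrow> ('g \<Rightarrow>\<^sub>L 'h)" where
  "hilbert_adjoint L = Blinfun (adjoint (blinfun_apply L))"

lemma riesz_representation:
  fixes f :: "'h::{real_inner, complete_space} \<Rightarrow> real"
  assumes "bounded_linear f"
  shows "\<exists>v. \<forall>x. f x = inner x v"
proof (cases "\<forall>x. f x = 0")
  case True
  then show ?thesis by (intro exI[of _ 0]) simp
next
  case False
  interpret f: bounded_linear f by fact
  define S where "S = {x. f x = 1}"
  from False obtain x0 where "f x0 \<noteq> 0" by blast
  then have "x0 /\<^sub>R f x0 \<in> S"
    by (simp add: S_def f.scaleR)
  then have ne: "norm ` S \<noteq> {}" by blast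
  have bdd: "bdd_below (norm ` S)"
    by (intro bdd_belowI[of _ 0]) auto
  define d where "d = Inf (norm ` S)"
  have d_le: "d \<le> norm x" if "x \<in> S" for x
    unfolding d_def using that bdd by (simp add: cInf_lower)
  have d0: "0 \<le> d"
    unfolding d_def using ne by (intro cInf_greatest) auto
  have "\<exists>x\<in>S. norm x < d + inverse (real (Suc n))" for n
  proof -
    have "Inf (norm ` S) < d + inverse (real (Suc n))"
      by (simp add: d_def)
    then show ?thesis
      using cInf_lessD[OF ne] by auto
  qed
  then obtain s where s: "\<And>n. s n \<in> S" "\<And>n. norm (s n) < d + inverse (real (Suc n))"
    by metis
  have lim: "(\<lambda>n. norm (s n)) \<longlonglongrightarrow> d"
  proof (rule tendsto_sandwich[where f = "\<lambda>n. d" and h = "\<lambda>n. d + inverse (real (Suc n))"])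
    show "(\<lambda>n. d + inverse (real (Suc n))) \<longlonglongrightarrow> d"
      by (rule LIMSEQ_inverse_real_of_nat_add)
    show "\<forall>\<^sub>F n in sequentially. norm (s n) \<le> d + inverse (real (Suc n))"
      using s(2) by (intro always_eventually allI less_imp_le)
    show "\<forall>\<^sub>F n in sequentially. d \<le> norm (s n)"
      using s(1) d_le by auto
  qed simp
  have par: "(dist (s m) (s n))\<^sup>2 \<le> 2 * (norm (s m))\<^sup>2 + 2 * (norm (s n))\<^sup>2 - 4 * d\<^sup>2" for m n
  proof -
    have "(1/2) *\<^sub>R (s m + s n) \<in> S"
      using s(1)[of m] s(1)[of n] by (simp add: S_def f.scaleR f.add)
    then have "d \<le> norm (s m + s n) / 2"
      using d_le by fastforce
    then have "(2 * d)\<^sup>2 \<le> (norm (s m + s n))\<^sup>2"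
      using d0 by (intro power_mono) auto
    moreover have "(norm (s m + s n))\<^sup>2 + (norm (s m - s n))\<^sup>2
        = 2 * (norm (s m))\<^sup>2 + 2 * (norm (s n))\<^sup>2"
      by (simp add: power2_norm_eq_inner inner_add_left inner_add_right inner_diff_left
          inner_diff_right inner_commute)
    ultimately show ?thesis
      by (simp add: dist_norm power_mult_distrib)
  qed
  have "Cauchy s"
    unfolding Cauchy_def
  proof (intro allI impI)
    fix e :: real assume e: "e > 0"
    have "(\<lambda>n. (norm (s n))\<^sup>2) \<longlonglongrightarrow> d\<^sup>2"
      using lim by (intro tendsto_intros)
    then have "\<forall>\<^sub>F n in sequentially. (norm (s n))\<^sup>2 < d\<^sup>2 + e\<^sup>2 / 4"
      using e by (intro order_tendstoD) auto
    then obtain N where N: "\<And>n. n \<ge> N \<Longrightarrow> (norm (s n))\<^sup>2 < d\<^sup>2 + e\<^sup>2 / 4"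
      unfolding eventually_sequentially by blast
    show "\<exists>M. \<forall>m\<ge>M. \<forall>n\<ge>M. dist (s m) (s n) < e"
    proof (intro exI allI impI)
      fix m n assume "m \<ge> N" "n \<ge> N"
      then have "(dist (s m) (s n))\<^sup>2 < e\<^sup>2"
        using par[of m n] N[of m] N[of n] by (simp add: field_simps)
      then show "dist (s m) (s n) < e"
        using e by (simp add: power2_less_imp_less)
    qed
  qed
  then obtain v where v: "s \<longlonglongrightarrow> v"
    using Cauchy_convergent convergent_def by blast
  have "(\<lambda>n. f (s n)) \<longlonglongrightarrow> f v"
    using v by (rule f.tendsto)
  moreover have "(\<lambda>n. f (s n)) = (\<lambda>n. 1)"
    using s(1) by (simp add: S_def)
  ultimately have fv: "f v = 1"
    by (metis LIMSEQ_unique tendsto_const)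
  have nv: "norm v = d"
    using tendsto_norm[OF v] lim by (rule LIMSEQ_unique)
  have orth: "inner w v = 0" if "f w = 0" for w
  proof (cases "w = 0")
    case False
    define t where "t = - inner w v / inner w w"
    have ww: "inner w w > 0" using False by simp
    have "v + t *\<^sub>R w \<in> S"
      using fv that by (simp add: S_def f.add f.scaleR)
    then have "(norm v)\<^sup>2 \<le> (norm (v + t *\<^sub>R w))\<^sup>2"
      using d_le nv by (intro power_mono) auto
    also have "\<dots> = (norm v)\<^sup>2 + 2 * t * inner w v + t\<^sup>2 * inner w w"
      by (simp only: power2_norm_eq_inner)
        (simp add: inner_add_left inner_add_right inner_commute power2_eq_square algebra_simps)
    also have "\<dots> = (norm v)\<^sup>2 - (inner w v)\<^sup>2 / inner w w"
      using ww by (simp add: t_def power2_eq_square field_simps)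
    finally have "(inner w v)\<^sup>2 \<le> 0"
      using ww by (simp add: divide_le_0_iff)
    then show ?thesis by simp
  qed simp
  have "v \<noteq> 0" using fv f.zero by auto
  show ?thesis
  proof (intro exI allI)
    fix x
    have "f (x - f x *\<^sub>R v) = 0"
      using fv by (simp add: f.diff f.scaleR)
    from orth[OF this] have "inner x v = f x * inner v v"
      by (simp add: inner_diff_left)
    then show "f x = inner x (v /\<^sub>R inner v v)"
      using \<open>v \<noteq> 0\<close> by simp
  qed
qed

lemma inner_hilbert_adjoint:
  fixes L :: "'h::{real_inner, complete_space} \<Rightarrow>\<^sub>L 'g::{real_inner, complete_space}"
  shows "inner (L x) y = inner x (hilbert_adjoint L y)"
proof -
  have "\<exists>v. \<forall>x. inner (L x) y = inner x v" for y
    by (rule riesz_representation)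
      (intro bounded_linear_compose[OF bounded_linear_inner_left] blinfun.bounded_linear_right)
  then obtain g where g: "\<And>x y. inner (L x) y = inner x (g y)"
    by metis
  then have adj: "adjoint (blinfun_apply L) = g"
    by (intro adjoint_unique) auto
  have eqI: "a = b" if "\<And>x. inner x a = inner x b" for a b :: 'h
    using that[of "a - b"] by (metis inner_eq_zero_iff inner_diff_right right_minus_eq)
  have "bounded_linear g"
  proof (rule bounded_linear_intro[where K = "norm L"])
    show "g (a + b) = g a + g b" for a b
      by (rule eqI) (simp add: g[symmetric] inner_add_right)
    show "g (r *\<^sub>R a) = r *\<^sub>R g a" for r a
      by (rule eqI) (simp add: g[symmetric])
    show "norm (g a) \<le> norm a * norm L" for a
    proof (cases "g a = 0")
      case False
      have "(norm (g a))\<^sup>2 = inner (L (g a)) a"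
        by (simp add: power2_norm_eq_inner g)
      also have "\<dots> \<le> norm (L (g a)) * norm a"
        by (rule norm_cauchy_schwarz)
      also have "\<dots> \<le> (norm L * norm (g a)) * norm a"
        by (intro mult_right_mono norm_blinfun) simp
      finally show ?thesis
        using False by (simp add: power2_eq_square ac_simps)
    qed simp
  qed
  then show ?thesis
    by (simp add: hilbert_adjoint_def adj bounded_linear_Blinfun_apply g)
qed


subsection \<open>Modes of convergence\<close>

definition converges_weakly :: "(nat \<Rightarrow> 'h::real_inner) \<Rightarrow> 'h \<Rightarrow> bool" where
  "converges_weakly z z' \<longleftrightarrow> (\<forall>u. (\<lambda>n. inner (z n) u) \<longlonglongrightarrow> inner z' u)"

definition converges_linearly :: "(nat \<Rightarrow> 'h::real_normed_vector) \<Rightarrow> 'h \<Rightarrow> bool" where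
  "converges_linearly z z' \<longleftrightarrow>
     (\<exists>R\<ge>0. \<exists>r. 0 < r \<and> r < 1 \<and> (\<forall>\<^sub>F n in sequentially. norm (z n - z') \<le> R * r ^ n))"


subsection \<open>The mismatched problem\<close>

definition D_op ::
  "real \<Rightarrow> ('g \<Rightarrow> 'g) \<Rightarrow> 'g \<Rightarrow> ('h::real_normed_vector \<Rightarrow>\<^sub>L 'g::real_normed_vector)
    \<Rightarrow> ('g \<Rightarrow>\<^sub>L 'h) \<Rightarrow> 'h \<Rightarrow> 'h" where
  "D_op \<alpha> B c L M = (\<lambda>x. \<alpha> *\<^sub>R M (L x - c) + M (B (L x)))"

definition solutions_P ::
  "('h \<Rightarrow> 'h set) \<Rightarrow> ('h \<Rightarrow> 'h) \<Rightarrow> real \<Rightarrow> ('g \<Rightarrow> 'g) \<Rightarrow> 'g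
    \<Rightarrow> ('h::real_normed_vector \<Rightarrow>\<^sub>L 'g::real_normed_vector) \<Rightarrow> ('g \<Rightarrow>\<^sub>L 'h) \<Rightarrow> 'h set" where
  "solutions_P A C \<alpha> B c L K =
     {x. 0 \<in> A x + {C x} + {\<alpha> *\<^sub>R K (L x - c)} + {K (B (L x))}}"

definition kappa ::
  "real \<Rightarrow> ('g \<Rightarrow> 'g) \<Rightarrow> ('h::real_normed_vector \<Rightarrow>\<^sub>L 'g::real_normed_vector)
    \<Rightarrow> ('g \<Rightarrow>\<^sub>L 'h) \<Rightarrow> real" where
  "kappa \<alpha> B L M = Lip (\<lambda>x. M (\<alpha> *\<^sub>R L x + B (L x)))"

definition zeta_tilde ::
  "('g \<Rightarrow> 'g) \<Rightarrow> ('h::real_normed_vector \<Rightarrow>\<^sub>L 'g::real_normed_vector)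
    \<Rightarrow> ('g \<Rightarrow>\<^sub>L 'h) \<Rightarrow> real" where
  "zeta_tilde B L M = Lip (\<lambda>x. M (B (L x)))"

text \<open>
  The set below is bounded below, and it is nonempty unless the space is \<open>{0}\<close>, in which case
  every operator \<open>D_op \<alpha> B c L K\<close> is zero.
\<close>
definition lambda_min ::
  "('h::real_inner \<Rightarrow>\<^sub>L 'g::real_normed_vector) \<Rightarrow> ('g \<Rightarrow>\<^sub>L 'h) \<Rightarrow> real" where
  "lambda_min L K = Inf {inner x (K (L x)) |x. norm x = 1}"

definition rho_hat ::
  "real \<Rightarrow> real \<Rightarrow> ('g \<Rightarrow> 'g)
    \<Rightarrow> ('h::{real_inner, complete_space} \<Rightarrow>\<^sub>L 'g::{real_inner, complete_space})
    \<Rightarrow> ('g \<Rightarrow>\<^sub>L 'h) \<Rightarrow> real" where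
  "rho_hat \<rho> \<alpha> B L K =
     \<rho> + \<alpha> * lambda_min L K - zeta_tilde B L (hilbert_adjoint L - K)"

definition step_sizes ::
  "real \<Rightarrow> real \<Rightarrow> real \<Rightarrow> ('g \<Rightarrow> 'g)
    \<Rightarrow> ('h::real_normed_vector \<Rightarrow>\<^sub>L 'g::real_normed_vector) \<Rightarrow> ('g \<Rightarrow>\<^sub>L 'h) \<Rightarrow> real set" where
  "step_sizes \<rho> \<beta> \<alpha> B L K =
     {\<gamma>. 0 < \<gamma> \<and> (kappa \<alpha> B L K)\<^sup>2 * \<gamma>\<^sup>2 * (1 + \<gamma> / (2 * \<beta>)) < 1 \<and> \<rho> * \<gamma> > -1}"

text \<open>In the next two definitions \<open>D\<close> stands for \<open>D_op \<alpha> B c L K\<close>.\<close>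

definition R_op ::
  "('h::real_vector \<Rightarrow> 'h set) \<Rightarrow> ('h \<Rightarrow> 'h) \<Rightarrow> ('h \<Rightarrow> 'h) \<Rightarrow> real \<Rightarrow> 'h \<Rightarrow> 'h" where
  "R_op A C D \<gamma> =
     (\<lambda>z. let x = resolvent (scale_op \<gamma> (single C)) z
          in resolvent (scale_op \<gamma> A) (2 *\<^sub>R x - z - \<gamma> *\<^sub>R D x))"

definition V_op ::
  "('h::real_vector \<Rightarrow> 'h set) \<Rightarrow> ('h \<Rightarrow> 'h) \<Rightarrow> ('h \<Rightarrow> 'h) \<Rightarrow> real \<Rightarrow> 'h \<Rightarrow> 'h" where
  "V_op A C D \<gamma> =
     (\<lambda>z. let x = resolvent (scale_op \<gamma> (single C)) z;
              y = R_op A C D \<gamma> z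
          in (y - \<gamma> *\<^sub>R D y) + z - (x - \<gamma> *\<^sub>R D x))"

end

theory Submission
  imports Defs
begin

text \<open>
  Write \<open>D\<close> for the mismatched operator \<open>x \<mapsto> \<alpha> K (L x - c) + K B L x\<close>.  The proof rests on one
  energy inequality for the exact step \<open>V\<close>.  Put \<open>x = J\<^bsub>\<gamma>C\<^esub> z\<close>, let \<open>y = R z\<close> be the outcome of the backward
  step, and let \<open>s\<close> be a solution, so that \<open>z\<^sub>s = s + \<gamma> C s\<close> is a fixed point of \<open>V\<close> with \<open>J\<^bsub>\<gamma>C\<^esub> z\<^sub>s = s\<close>.
  The step moves \<open>z\<close> by \<open>- \<gamma> (a + D y + C x)\<close> with \<open>a \<in> A y\<close>.  Expanding the square and using that
  \<open>A + D\<close> is \<open>\<sigma>\<close>-monotone with \<open>\<sigma> \<ge> 0\<close> (with \<open>\<sigma> = rho_hat\<close>), that \<open>C\<close>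
  is cocoercive, and that \<open>D\<close> is Lipschitz continuous with \<open>\<gamma>\<close> below the stated bound, one gets
  \<open>\<parallel>V z - z\<^sub>s\<parallel>\<^sup>2 \<le> \<parallel>z - z\<^sub>s\<parallel>\<^sup>2 - \<epsilon> (\<parallel>x - y\<parallel>\<^sup>2 + \<gamma>\<^sup>2 \<parallel>C x - C s\<parallel>\<^sup>2) - 2 \<gamma> \<sigma> \<parallel>y - s\<parallel>\<^sup>2\<close>
  for some \<open>\<epsilon> > 0\<close> (lemma \<open>energy_decrease\<close>).

  Replacing \<open>K\<close> by \<open>K\<^sub>n\<close> changes the step by at most \<open>M \<omega>\<^sub>n (1 + \<parallel>z\<^sub>n - z\<^sub>s\<parallel>)\<close> (lemma \<open>step_deviation\<close>).
  As \<open>\<omega>\<close> is summable, \<open>\<parallel>z\<^sub>n - z\<^sub>s\<parallel>\<close> still converges for every solution \<open>s\<close>, and the energy inequality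
  then forces \<open>x\<^sub>n - y\<^sub>n \<longlonglongrightarrow> 0\<close>, where \<open>y\<^sub>n\<close> is computed from \<open>z\<^sub>n\<close> by the exact step, and
  \<open>C x\<^sub>n \<longlonglongrightarrow> C s\<close>.  Hence \<open>A + D + C\<close> has elements at \<open>y\<^sub>n\<close> that tend to \<open>0\<close>,
  and a closure property of its graph identifies the possible weak limits as
  fixed points; Opial's argument (lemma \<open>opial\<close>) yields weak convergence.  If \<open>\<sigma> > 0\<close>, the three
  subtracted terms control \<open>\<parallel>z - z\<^sub>s\<parallel>\<^sup>2\<close>, because \<open>z - z\<^sub>s = (x - y) + \<gamma> (C x - C s) + (y - s)\<close>; so \<open>V\<close>
  is a contraction towards \<open>z\<^sub>s\<close>, and a geometric perturbation preserves linear convergence.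

  Two facts about Hilbert spaces are obtained directly by optimizing quadratic functions over convex
  sets, where the parallelogram law makes optimizing sequences Cauchy.  Minty's surjectivity
  theorem (lemma \<open>minty\<close>) comes from maximizing a concave quadratic over a convex hull.  In place of
  weak sequential compactness, the points in the closed convex hulls of all tails of a
  bounded sequence are used: such points exist (lemma \<open>bounded_seq_has_point_of_tail_hulls\<close>), and
  the inequalities that characterize a solution are affine, hence pass to them.
\<close>

section \<open>Monotone sets and a point related to all of their elements\<close>

text \<open>
  The symmetric form \<open>f\<close> in the proof is affine in each argument, so its nonnegativity, which
  on the generators is monotonicity of \<open>G\<close>, passes to the hull in one argument and then in the other.
  On the diagonal it equals \<open>2 (s - inner a u)\<close>.
\<close>
lemma inner_le_on_convex_hull_of_graph:
  fixes G :: "('h::real_inner \<times> 'h) set"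
  assumes mono: "\<And>a u b v. (a, u) \<in> G \<Longrightarrow> (b, v) \<in> G \<Longrightarrow> 0 \<le> inner (a - b) (u - v)"
    and mem: "(a, u, s) \<in> convex hull ((\<lambda>(a, u). (a, u, inner a u)) ` G)"
  shows "inner a u \<le> s"
proof -
  define f :: "'h \<times> 'h \<times> real \<Rightarrow> 'h \<times> 'h \<times> real \<Rightarrow> real"
    where "f = (\<lambda>(b, v, r) (a, u, s). s - inner a v - inner b u + r)"
  have convex_f: "convex {P. 0 \<le> f Q P}" for Q
  proof (rule convexI)
    fix P P' :: "'h \<times> 'h \<times> real" and l m :: real
    assume PP': "P \<in> {P. 0 \<le> f Q P}" "P' \<in> {P. 0 \<le> f Q P}" and lm: "0 \<le> l" "0 \<le> m" "l + m = 1"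
    have "f Q (l *\<^sub>R P + m *\<^sub>R P') = l * f Q P + m * f Q P' + (1 - (l + m)) * snd (snd Q)"
      by (cases Q, cases P, cases P')
        (simp add: f_def inner_add_left inner_add_right algebra_simps)
    then show "l *\<^sub>R P + m *\<^sub>R P' \<in> {P. 0 \<le> f Q P}"
      using PP' lm by simp
  qed
  let ?X = "(\<lambda>(a, u). (a, u, inner a u)) ` G"
  have 1: "0 \<le> f Q P" if "P \<in> ?X" "Q \<in> ?X" for P Q
    using that mono by (fastforce simp: f_def inner_diff_left inner_diff_right inner_commute)
  have "convex hull ?X \<subseteq> {P. 0 \<le> f Q P}" if "Q \<in> ?X" for Q
    using 1[OF _ that] convex_f by (intro hull_minimal subsetI CollectI)
  moreover have sym: "f P Q = f Q P" for P Q
    by (cases P, cases Q) (simp add: f_def inner_commute)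
  ultimately have "0 \<le> f Q P" if "Q \<in> convex hull ?X" "P \<in> ?X" for P Q
    using that by (metis (mono_tags, lifting) mem_Collect_eq subsetD)
  then have "convex hull ?X \<subseteq> {P. 0 \<le> f Q P}" if "Q \<in> convex hull ?X" for Q
    using convex_f that by (intro hull_minimal subsetI CollectI) blast
  then have "0 \<le> f (a, u, s) (a, u, s)"
    using mem by blast
  then show ?thesis
    by (simp add: f_def)
qed

lemma Cauchy_if_dist_square_le:
  fixes v :: "nat \<Rightarrow> 'a::metric_space"
  assumes "\<And>m n. m \<le> n \<Longrightarrow> (dist (v m) (v n))\<^sup>2 \<le> e m" and "e \<longlonglongrightarrow> 0"
  shows "Cauchy v"
  unfolding Cauchy_altdef
proof (intro allI impI)
  fix r :: real assume r: "0 < r"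
  then have "\<forall>\<^sub>F m in sequentially. e m < r\<^sup>2"
    using assms(2) by (intro order_tendstoD) auto
  then obtain N where N: "\<And>m. N \<le> m \<Longrightarrow> e m < r\<^sup>2"
    unfolding eventually_sequentially by blast
  show "\<exists>M. \<forall>m\<ge>M. \<forall>n>m. dist (v m) (v n) < r"
  proof (intro exI allI impI)
    fix m n assume "N \<le> m" "m < n"
    then have "(dist (v m) (v n))\<^sup>2 < r\<^sup>2"
      using assms(1)[of m n] N[of m] by simp
    then show "dist (v m) (v n) < r"
      using r by (simp add: power2_less_imp_less)
  qed
qed

text \<open>
  The Debrunner--Flor extension step.  A point \<open>x\<close> is suitable iff
  \<open>\<parallel>x\<parallel>\<^sup>2 + inner x (u - a) - inner a u \<le> 0\<close> for all \<open>(a, u) \<in> G\<close>.  By Lagrange duality the maximum of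
  these functions is minimized by way of their convex combinations: the combination given by a
  point \<open>(a, u, s)\<close> of the hull of the triples \<open>(a, u, inner a u)\<close> has minimum \<open>g (a, u, s)\<close>, attained
  at \<open>- (u - a) / 2\<close>.  Monotonicity makes \<open>g \<le> 0\<close>.  As \<open>g\<close> is strongly concave in \<open>u - a\<close>, a maximizing
  sequence has converging \<open>u - a\<close>, and first-order optimality in the direction of each generator gives
  the claim.
\<close>
lemma monotone_set_has_related_point:
  fixes G :: "('h::{real_inner, complete_space} \<times> 'h) set"
  assumes mono: "\<And>a u b v. (a, u) \<in> G \<Longrightarrow> (b, v) \<in> G \<Longrightarrow> 0 \<le> inner (a - b) (u - v)"
  shows "\<exists>x. \<forall>(a, u) \<in> G. 0 \<le> inner (x - a) (- x - u)"
proof (cases "G = {}")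
  case False
  let ?X = "(\<lambda>(a, u). (a, u, inner a u)) ` G"
  define H where "H = convex hull ?X"
  define g :: "'h \<times> 'h \<times> real \<Rightarrow> real" where "g = (\<lambda>(a, u, s). - (norm (u - a))\<^sup>2 / 4 - s)"
  define \<delta> :: "'h \<times> 'h \<times> real \<Rightarrow> 'h" where "\<delta> = (\<lambda>(a, u, s). u - a)"
  have g_le0: "g P \<le> 0" if "P \<in> H" for P
  proof -
    obtain a u s where P: "P = (a, u, s)" by (cases P)
    have "inner a u \<le> s"
      using inner_le_on_convex_hull_of_graph[OF mono] that P unfolding H_def by blast
    moreover have "0 \<le> (norm (u + a))\<^sup>2" by simp
    ultimately show ?thesis
      by (simp add: P g_def power2_norm_eq_inner inner_add_left inner_add_right inner_diff_left
          inner_diff_right inner_commute)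
  qed
  define gs where "gs = Sup (g ` H)"
  have ne: "g ` H \<noteq> {}" using False by (simp add: H_def)
  have g_le: "g P \<le> gs" if "P \<in> H" for P
    unfolding gs_def using that g_le0 by (intro cSup_upper bdd_aboveI[of _ 0]) auto
  have gs0: "gs \<le> 0"
    unfolding gs_def using g_le0 ne by (intro cSup_least) auto
  define i where "i = (\<lambda>n. inverse (real (Suc n)))"
  have i: "0 < i n" "i \<longlonglongrightarrow> 0" for n
    using LIMSEQ_inverse_real_of_nat by (simp_all add: i_def)
  have "\<exists>P \<in> H. gs - i n < g P" for n
    using less_cSupD[OF ne, of "gs - i n"] i(1)[of n] by (auto simp: gs_def[symmetric])
  then obtain P where P: "\<And>n. P n \<in> H" "\<And>n. gs - i n < g (P n)"
    by metis
  \<comment> \<open>The exact modulus of concavity of \<open>g\<close> along a segment.\<close>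
  have expand: "g ((1 - t) *\<^sub>R Q + t *\<^sub>R Q')
      = (1 - t) * g Q + t * g Q' + t * (1 - t) * (norm (\<delta> Q' - \<delta> Q))\<^sup>2 / 4" for t Q Q'
    by (cases Q, cases Q')
      (simp add: g_def \<delta>_def power2_norm_eq_inner inner_add_left inner_add_right inner_diff_left
          inner_diff_right inner_commute field_simps)
  have mix: "(1 - t) *\<^sub>R Q + t *\<^sub>R Q' \<in> H"
    if "Q \<in> H" "Q' \<in> H" "0 \<le> t" "t \<le> 1" for t Q Q'
    using that unfolding H_def by (intro convexD) auto
  have "Cauchy (\<lambda>n. \<delta> (P n))"
  proof (rule Cauchy_if_dist_square_le)
    fix m n :: nat assume mn: "m \<le> n"
    have "g ((1 - 1/2) *\<^sub>R P m + (1/2) *\<^sub>R P n) \<le> gs"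
      by (intro g_le mix P) auto
    then have "g (P m) / 2 + g (P n) / 2 + (norm (\<delta> (P n) - \<delta> (P m)))\<^sup>2 / 16 \<le> gs"
      unfolding expand by simp
    moreover have "i n \<le> i m"
      using mn by (simp add: i_def)
    ultimately have "(norm (\<delta> (P n) - \<delta> (P m)))\<^sup>2 \<le> 16 * i m"
      using P(2)[of m] P(2)[of n] by linarith
    then show "(dist (\<delta> (P m)) (\<delta> (P n)))\<^sup>2 \<le> 16 * i m"
      by (simp only: dist_norm norm_minus_commute)
  qed (use i(2) in \<open>auto intro!: tendsto_eq_intros\<close>)
  then obtain v where v: "(\<lambda>n. \<delta> (P n)) \<longlonglongrightarrow> v"
    using Cauchy_convergent convergent_def by blast
  have gP: "(\<lambda>n. g (P n)) \<longlonglongrightarrow> gs"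
    by (rule tendsto_sandwich[where f = "\<lambda>n. gs - i n" and h = "\<lambda>n. gs"])
      (use P g_le in \<open>auto intro!: less_imp_le tendsto_eq_intros i(2) always_eventually\<close>)
  show ?thesis
  proof (intro exI ballI, clarify)
    fix b w assume bw: "(b, w) \<in> G"
    define Q where "Q = (b, w, inner b w)"
    have Q: "Q \<in> H"
      using bw unfolding H_def by (intro hull_inc) (force simp: Q_def)
    define N where "N = (norm (w - b - v))\<^sup>2 / 4"
    \<comment> \<open>\<open>\<phi>\<close> is the value at \<open>- v / 2\<close> of the quadratic that belongs to \<open>(b, w)\<close>.\<close>
    define \<phi> where "\<phi> = g Q + N"
    \<comment> \<open>Moving from the maximizing sequence towards \<open>Q\<close> by \<open>t\<close> cannot exceed the supremum \<open>gs\<close>.\<close>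
    have le: "\<phi> - gs \<le> t * N" if t: "0 < t" "t \<le> 1" for t
    proof -
      have "(1 - t) * g (P n) + t * g Q + t * (1 - t) * (norm (\<delta> Q - \<delta> (P n)))\<^sup>2 / 4 \<le> gs" for n
        using g_le[OF mix[OF P(1) Q]] t unfolding expand by simp
      moreover have "(\<lambda>n. (1 - t) * g (P n) + t * g Q + t * (1 - t) * (norm (\<delta> Q - \<delta> (P n)))\<^sup>2 / 4)
          \<longlonglongrightarrow> (1 - t) * gs + t * g Q + t * (1 - t) * (norm (\<delta> Q - v))\<^sup>2 / 4"
        by (intro tendsto_intros gP v) simp
      ultimately have "(1 - t) * gs + t * g Q + t * (1 - t) * (norm (\<delta> Q - v))\<^sup>2 / 4 \<le> gs"
        using LIMSEQ_le_const2 by blast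
      then have "t * (\<phi> - gs) \<le> t * (t * N)"
        by (simp add: N_def \<phi>_def Q_def \<delta>_def field_simps)
      then show ?thesis using t by simp
    qed
    have "\<phi> - gs \<le> 0"
    proof (rule ccontr)
      assume pos: "\<not> \<phi> - gs \<le> 0"
      then have N: "\<phi> - gs \<le> N" "0 < N" using le[of 1] by auto
      with pos have "\<phi> - gs \<le> (\<phi> - gs) / (2 * N) * N"
        by (intro le) (auto simp: field_simps)
      then show False using pos N by simp
    qed
    then have "\<phi> \<le> 0" using gs0 by simp
    then show "0 \<le> inner (- (1/2) *\<^sub>R v - b) (- (- (1/2) *\<^sub>R v) - w)"
      by (simp add: \<phi>_def N_def Q_def g_def power2_norm_eq_inner inner_add_left inner_add_right
          inner_diff_left inner_diff_right inner_commute field_simps)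
  qed
qed simp

section \<open>Resolvents of maximally \<open>\<rho>\<close>-monotone operators\<close>

lemma max_rho_monotone_memI:
  assumes max: "max_rho_monotone \<rho> A"
    and related: "\<And>a u. u \<in> A a \<Longrightarrow> \<rho> * (norm (x - a))\<^sup>2 \<le> inner (x - a) (v - u)"
  shows "v \<in> A x"
proof -
  define A' where "A' = A(x := insert v (A x))"
  have 1: "\<rho> * (norm (a - b))\<^sup>2 \<le> inner (a - b) (u - w)" if "u \<in> A a" "w \<in> A b" for a b u w
    using max that unfolding max_rho_monotone_def rho_monotone_def gra_def by fastforce
  have 2: "\<rho> * (norm (a - x))\<^sup>2 \<le> inner (a - x) (u - v)" if "u \<in> A a" for a u
    using related[OF that]
    by (simp add: norm_minus_commute inner_diff_left inner_diff_right)
  have "rho_monotone \<rho> A'"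
    using 1 2 related by (auto simp: rho_monotone_def gra_def A'_def split: if_splits)
  moreover have "gra A \<subseteq> gra A'" "(x, v) \<in> gra A'"
    by (auto simp: gra_def A'_def)
  ultimately have "(x, v) \<in> gra A"
    using max unfolding max_rho_monotone_def by blast
  then show ?thesis by (simp add: gra_def)
qed

lemma max_rho_monotoneD:
  assumes "max_rho_monotone \<rho> A" "u \<in> A a" "w \<in> A b"
  shows "\<rho> * (norm (a - b))\<^sup>2 \<le> inner (a - b) (u - w)"
  using assms unfolding max_rho_monotone_def rho_monotone_def gra_def by fastforce

text \<open>
  The operator \<open>\<gamma> A - \<rho> \<gamma> Id\<close> is monotone, and the inclusion to be solved is
  \<open>z \<in> \<mu> x + (\<gamma> A - \<rho> \<gamma> Id) x\<close> with \<open>\<mu> = 1 + \<rho> \<gamma> > 0\<close>.  After division by \<open>\<mu>\<close> and translation by \<open>z\<close>, a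
  point related to the whole graph exists, and maximality of \<open>A\<close> puts it into the graph.
\<close>
lemma minty:
  fixes A :: "'h::{real_inner, complete_space} \<Rightarrow> 'h set"
  assumes max: "max_rho_monotone \<rho> A" and \<gamma>: "0 < \<gamma>" "- 1 < \<rho> * \<gamma>"
  shows "\<exists>x. \<exists>a \<in> A x. x + \<gamma> *\<^sub>R a = z"
proof -
  define \<mu> where "\<mu> = 1 + \<rho> * \<gamma>"
  have \<mu>: "0 < \<mu>" using \<gamma> by (simp add: \<mu>_def)
  define s where "s = (\<lambda>(b, u). (b, (1 / \<mu>) *\<^sub>R (\<gamma> *\<^sub>R u - (\<rho> * \<gamma>) *\<^sub>R b - z)))"
  have "\<exists>x. \<forall>(a, u) \<in> s ` gra A. 0 \<le> inner (x - a) (- x - u)"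
  proof (rule monotone_set_has_related_point)
    fix a u b v assume "(a, u) \<in> s ` gra A" "(b, v) \<in> s ` gra A"
    then obtain u' v' where uv: "u' \<in> A a" "v' \<in> A b"
      "u = (1 / \<mu>) *\<^sub>R (\<gamma> *\<^sub>R u' - (\<rho> * \<gamma>) *\<^sub>R a - z)"
      "v = (1 / \<mu>) *\<^sub>R (\<gamma> *\<^sub>R v' - (\<rho> * \<gamma>) *\<^sub>R b - z)"
      by (auto simp: s_def gra_def)
    have "inner (a - b) (u - v) = (\<gamma> / \<mu>) * (inner (a - b) (u' - v') - \<rho> * (norm (a - b))\<^sup>2)"
      unfolding uv(3,4) power2_norm_eq_inner
      by (simp add: inner_diff_left inner_diff_right inner_commute algebra_simps)
    moreover have "\<rho> * (norm (a - b))\<^sup>2 \<le> inner (a - b) (u' - v')"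
      using max uv by (intro max_rho_monotoneD)
    ultimately show "0 \<le> inner (a - b) (u - v)"
      using \<gamma> \<mu> by simp
  qed
  then obtain x where x: "\<And>a u. (a, u) \<in> s ` gra A \<Longrightarrow> 0 \<le> inner (x - a) (- x - u)"
    by blast
  have cancel: "\<mu> *\<^sub>R (1 / \<mu>) *\<^sub>R w = w" for w :: 'h
    using \<mu> by simp
  have "(1 / \<gamma>) *\<^sub>R (z - x) \<in> A x"
  proof (rule max_rho_monotone_memI[OF max])
    fix b u assume "u \<in> A b"
    then have "s (b, u) \<in> s ` gra A" by (simp add: gra_def)
    then have "0 \<le> inner (x - b) (- x - (1 / \<mu>) *\<^sub>R (\<gamma> *\<^sub>R u - (\<rho> * \<gamma>) *\<^sub>R b - z))"
      by (intro x) (simp add: s_def)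
    then have "0 \<le> \<mu> * inner (x - b) (- x - (1 / \<mu>) *\<^sub>R (\<gamma> *\<^sub>R u - (\<rho> * \<gamma>) *\<^sub>R b - z))"
      using \<mu> by simp
    also have "\<dots> = inner (x - b) (\<mu> *\<^sub>R (- x - (1 / \<mu>) *\<^sub>R (\<gamma> *\<^sub>R u - (\<rho> * \<gamma>) *\<^sub>R b - z)))"
      by simp
    also have "\<mu> *\<^sub>R (- x - (1 / \<mu>) *\<^sub>R (\<gamma> *\<^sub>R u - (\<rho> * \<gamma>) *\<^sub>R b - z))
        = z - x - \<gamma> *\<^sub>R u - (\<rho> * \<gamma>) *\<^sub>R (x - b)"
      unfolding scaleR_diff_right[of \<mu>] cancel by (simp add: \<mu>_def algebra_simps)
    also have "\<dots> = \<gamma> *\<^sub>R (((1 / \<gamma>) *\<^sub>R (z - x) - u) - \<rho> *\<^sub>R (x - b))"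
      using \<gamma> by (simp add: scaleR_diff_right mult.commute)
    also have "inner (x - b) \<dots> = \<gamma> * (inner (x - b) ((1 / \<gamma>) *\<^sub>R (z - x) - u) - \<rho> * (norm (x - b))\<^sup>2)"
      by (simp only: inner_scaleR_right inner_diff_right[of _ "_ - u"] power2_norm_eq_inner)
    finally show "\<rho> * (norm (x - b))\<^sup>2 \<le> inner (x - b) ((1 / \<gamma>) *\<^sub>R (z - x) - u)"
      using \<gamma> by (simp add: zero_le_mult_iff)
  qed
  moreover have "x + \<gamma> *\<^sub>R ((1 / \<gamma>) *\<^sub>R (z - x)) = z"
    using \<gamma> by simp
  ultimately show ?thesis by blast
qed

lemma resolvent_expansive:
  assumes max: "max_rho_monotone \<rho> A" and \<gamma>: "0 < \<gamma>" and ab: "a \<in> A p" "b \<in> A q"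
  shows "(1 + \<rho> * \<gamma>) * norm (p - q) \<le> norm ((p + \<gamma> *\<^sub>R a) - (q + \<gamma> *\<^sub>R b))"
proof (cases "p = q")
  case False
  have "\<gamma> * (\<rho> * (norm (p - q))\<^sup>2) \<le> \<gamma> * inner (p - q) (a - b)"
    using max_rho_monotoneD[OF max ab] \<gamma> by simp
  then have "((1 + \<rho> * \<gamma>) * norm (p - q)) * norm (p - q)
      \<le> inner (p - q) ((p + \<gamma> *\<^sub>R a) - (q + \<gamma> *\<^sub>R b))"
    unfolding power2_norm_eq_inner mult.assoc power2_eq_square[symmetric]
    by (simp add: inner_diff_left inner_diff_right inner_add_right inner_add_left inner_commute algebra_simps)
  also have "\<dots> \<le> norm ((p + \<gamma> *\<^sub>R a) - (q + \<gamma> *\<^sub>R b)) * norm (p - q)"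
    using norm_cauchy_schwarz by (simp add: mult.commute)
  finally show ?thesis using False by simp
qed simp

lemma resolvent_eqI:
  fixes A :: "'h::real_inner \<Rightarrow> 'h set"
  assumes max: "max_rho_monotone \<rho> A" and \<gamma>: "0 < \<gamma>" "- 1 < \<rho> * \<gamma>"
    and a: "a \<in> A p" "p + \<gamma> *\<^sub>R a = z"
  shows "resolvent (scale_op \<gamma> A) z = p"
proof -
  have "q = p" if "b \<in> A q" "q + \<gamma> *\<^sub>R b = z" for q b
  proof -
    have "(1 + \<rho> * \<gamma>) * norm (q - p) \<le> 0"
      using resolvent_expansive[OF max \<gamma>(1) that(1) a(1)] that(2) a(2) by simp
    then show ?thesis using \<gamma> by (simp add: mult_le_0_iff)
  qed
  then have "{q. \<exists>b \<in> A q. q + \<gamma> *\<^sub>R b = z} = {p}"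
    using a by blast
  moreover have "inverse_op (\<lambda>x. {x} + scale_op \<gamma> A x) z = {q. \<exists>b \<in> A q. q + \<gamma> *\<^sub>R b = z}"
    unfolding inverse_op_def scale_op_def set_plus_def by blast
  ultimately show ?thesis by (simp add: resolvent_def)
qed

lemma resolventE:
  fixes A :: "'h::{real_inner, complete_space} \<Rightarrow> 'h set"
  assumes "max_rho_monotone \<rho> A" "0 < \<gamma>" "- 1 < \<rho> * \<gamma>"
  obtains a where "a \<in> A (resolvent (scale_op \<gamma> A) z)" "resolvent (scale_op \<gamma> A) z + \<gamma> *\<^sub>R a = z"
  using minty[OF assms, of z] resolvent_eqI[OF assms] by metis

lemma resolvent_lipschitz:
  fixes A :: "'h::{real_inner, complete_space} \<Rightarrow> 'h set"
  assumes A: "max_rho_monotone \<rho> A" "0 < \<gamma>" "- 1 < \<rho> * \<gamma>"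
  shows "(1 + \<rho> * \<gamma>) * norm (resolvent (scale_op \<gamma> A) z - resolvent (scale_op \<gamma> A) z') \<le> norm (z - z')"
  using resolvent_expansive[OF A(1,2)] resolventE[OF A] by metis

text \<open>
  Minty's trick: comparing \<open>(x, u)\<close> with the graph at \<open>x + t h\<close>, where \<open>h = u - C x\<close>, bounds
  \<open>\<parallel>h\<parallel>\<^sup>2\<close> by \<open>t l \<parallel>h\<parallel>\<^sup>2\<close>.
\<close>
lemma lipschitz_monotone_imp_max_rho_monotone:
  fixes C :: "'h::real_inner \<Rightarrow> 'h"
  assumes lip: "l-lipschitz_on UNIV C" and mono: "\<And>x y. 0 \<le> inner (x - y) (C x - C y)"
  shows "max_rho_monotone 0 (single C)"
  unfolding max_rho_monotone_def
proof (intro conjI allI impI)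
  show "rho_monotone 0 (single C)"
    using mono by (auto simp: rho_monotone_def gra_def single_def)
  fix A' assume A': "rho_monotone 0 A' \<and> gra (single C) \<subseteq> gra A'"
  have "u = C x" if "u \<in> A' x" for x u
  proof -
    define h where "h = u - C x"
    define t where "t = 1 / (2 * (l + 1))"
    have l: "0 \<le> l" using lip by (rule lipschitz_on_nonneg)
    then have t: "0 < t" "t * l \<le> 1 / 2" by (auto simp: t_def field_simps)
    have "C (x + t *\<^sub>R h) \<in> A' (x + t *\<^sub>R h)"
      using A' by (auto simp: gra_def single_def)
    then have "0 \<le> inner (x - (x + t *\<^sub>R h)) (u - C (x + t *\<^sub>R h))"
      using A' that unfolding rho_monotone_def gra_def by fastforce
    then have "inner h (u - C (x + t *\<^sub>R h)) \<le> 0"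
      using t by (simp add: mult_le_0_iff)
    then have "(norm h)\<^sup>2 \<le> inner h (C (x + t *\<^sub>R h) - C x)"
      by (simp add: h_def power2_norm_eq_inner inner_diff_right)
    also have "\<dots> \<le> norm h * norm (C (x + t *\<^sub>R h) - C x)"
      by (rule norm_cauchy_schwarz)
    also have "\<dots> \<le> norm h * (l * norm (t *\<^sub>R h))"
      using lipschitz_onD[OF lip, of "x + t *\<^sub>R h" x]
      by (intro mult_left_mono) (auto simp: dist_norm)
    also have "\<dots> = (t * l) * (norm h)\<^sup>2"
      using t by (simp add: power2_eq_square)
    also have "\<dots> \<le> 1 / 2 * (norm h)\<^sup>2"
      using t by (intro mult_right_mono) auto
    finally have "(norm h)\<^sup>2 \<le> 0" by linarith
    then show ?thesis by (simp add: h_def)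
  qed
  with A' show "gra A' = gra (single C)"
    by (auto simp: gra_def single_def)
qed

text \<open>
  The graph of \<open>A + F\<close> contains every point of the form \<open>(x, 0)\<close> that is monotonically related to it.
  Minty's theorem for \<open>t A\<close> at \<open>x - t F x\<close> gives \<open>a \<in> A y\<close> with
  \<open>a + F y = (x - y) / t + (F y - F x)\<close>.  For \<open>t l < 1\<close> the first term dominates, so
  \<open>inner (y - x) (a + F y)\<close> would be negative unless \<open>y = x\<close>.
\<close>
lemma zero_of_monotonically_related:
  fixes A :: "'h::{real_inner, complete_space} \<Rightarrow> 'h set"
  assumes max: "max_rho_monotone \<rho> A" and lip: "l-lipschitz_on UNIV F"
    and related: "\<And>y a. a \<in> A y \<Longrightarrow> 0 \<le> inner (y - x) (a + F y)"
  shows "- F x \<in> A x"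
proof -
  have l: "0 \<le> l" using lip by (rule lipschitz_on_nonneg)
  define t where "t = 1 / (\<bar>\<rho>\<bar> + l + 1)"
  have t: "0 < t" "- 1 < \<rho> * t" "t * l < 1" using l by (auto simp: t_def field_simps)
  obtain y a where y: "a \<in> A y" "y + t *\<^sub>R a = x - t *\<^sub>R F x"
    using minty[OF max t(1,2)] by blast
  have ta: "t *\<^sub>R a = (x - y) - t *\<^sub>R F x"
    using y(2) by (simp add: algebra_simps)
  have "0 \<le> t * inner (y - x) (a + F y)"
    using related[OF y(1)] t by simp
  also have "\<dots> = inner (y - x) (t *\<^sub>R a + t *\<^sub>R F y)"
    by (simp add: inner_add_right distrib_left)
  also have "\<dots> = - (norm (y - x))\<^sup>2 + t * inner (y - x) (F y - F x)"
    unfolding ta power2_norm_eq_inner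
    by (simp add: inner_diff_left inner_diff_right inner_add_right inner_commute algebra_simps)
  also have "inner (y - x) (F y - F x) \<le> norm (y - x) * norm (F y - F x)"
    by (rule norm_cauchy_schwarz)
  also have "\<dots> \<le> norm (y - x) * (l * norm (y - x))"
    using lipschitz_onD[OF lip, of y x] by (intro mult_left_mono) (auto simp: dist_norm)
  finally have "0 \<le> - ((1 - t * l) * (norm (y - x))\<^sup>2)"
    using t by (simp add: power2_eq_square algebra_simps)
  then have "(1 - t * l) * (norm (y - x))\<^sup>2 \<le> 0" by simp
  then have "y = x" using t by (simp add: mult_le_0_iff)
  moreover have "a = - F x"
    using ta t by (simp add: \<open>y = x\<close>) (metis scaleR_cancel_left scaleR_minus_right less_irrefl)
  ultimately show ?thesis using y by simp
qed

section \<open>Weak convergence and perturbed recursions\<close>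

text \<open>
  A substitute for weak sequential compactness: the point \<open>p\<close> lies in the closed convex hull of every
  tail.  It is the limit of almost minimal norm elements of these hulls; their minimal norms
  increase to a finite limit, so the parallelogram law makes the elements a Cauchy sequence.
\<close>
lemma bounded_seq_has_point_of_tail_hulls:
  fixes z :: "nat \<Rightarrow> 'h::{real_inner, complete_space}"
  assumes bounded: "\<And>n. norm (z n) \<le> M"
  shows "\<exists>p. \<forall>u b. (\<forall>\<^sub>F n in sequentially. inner (z n) u \<le> b) \<longrightarrow> inner p u \<le> b"
proof -
  define S where "S = (\<lambda>n. convex hull (z ` {n..}))"
  define d where "d = (\<lambda>n. Inf ((\<lambda>x. (norm x)\<^sup>2) ` S n))"
  define i where "i = (\<lambda>n. inverse (real (Suc n)))"
  have i: "0 < i n" "i \<longlonglongrightarrow> 0" for n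
    using LIMSEQ_inverse_real_of_nat by (simp_all add: i_def)
  have zS: "z n \<in> S n" for n
    unfolding S_def by (intro hull_inc) auto
  have anti: "S n \<subseteq> S m" if "m \<le> n" for m n
    unfolding S_def using that by (intro hull_mono) auto
  have ne: "(\<lambda>x. (norm x)\<^sup>2) ` S n \<noteq> {}" for n
    using zS by blast
  have bdd: "bdd_below ((\<lambda>x. (norm x)\<^sup>2) ` S n)" for n
    by (intro bdd_belowI[of _ 0]) auto
  have d_le: "d n \<le> (norm x)\<^sup>2" if "x \<in> S n" for n x
    unfolding d_def using that bdd by (simp add: cInf_lower)
  have "incseq d"
    unfolding incseq_def d_def
    using anti ne bdd by (intro allI impI cInf_superset_mono image_mono) auto
  moreover have "d n \<le> M\<^sup>2" for n
    using d_le[OF zS] power_mono[OF bounded norm_ge_zero, of n 2] by (rule order_trans)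
  ultimately obtain ds where ds: "d \<longlonglongrightarrow> ds" "\<And>n. d n \<le> ds"
    using incseq_convergent[of d "M\<^sup>2"] by blast
  have "\<exists>x \<in> S n. (norm x)\<^sup>2 < d n + i n" for n
    using cInf_lessD[OF ne, of n "d n + i n"] i(1)[of n] by (auto simp: d_def)
  then obtain p where p: "\<And>n. p n \<in> S n" "\<And>n. (norm (p n))\<^sup>2 < d n + i n"
    by metis
  have "Cauchy p"
  proof (rule Cauchy_if_dist_square_le)
    fix m n :: nat assume mn: "m \<le> n"
    have "(1 - 1/2) *\<^sub>R p m + (1/2) *\<^sub>R p n \<in> S m"
      using p(1) anti[OF mn] unfolding S_def by (intro convexD) auto
    from d_le[OF this] have "4 * d m \<le> (norm (p m + p n))\<^sup>2"
      by (simp add: scaleR_add_right[symmetric] power_divide)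
    moreover have "(norm (p m + p n))\<^sup>2 + (dist (p m) (p n))\<^sup>2 = 2 * (norm (p m))\<^sup>2 + 2 * (norm (p n))\<^sup>2"
      by (simp add: dist_norm power2_norm_eq_inner inner_add_left inner_add_right inner_diff_left
          inner_diff_right inner_commute)
    moreover have "i n \<le> i m"
      using mn by (simp add: i_def)
    ultimately show "(dist (p m) (p n))\<^sup>2 \<le> 2 * (ds - d m) + 4 * i m"
      using p(2)[of m] p(2)[of n] ds(2)[of n] by argo
  qed (use i(2) ds(1) in \<open>auto intro!: tendsto_eq_intros\<close>)
  then obtain q where q: "p \<longlonglongrightarrow> q"
    using Cauchy_convergent convergent_def by blast
  have "inner q u \<le> b" if ev: "\<forall>\<^sub>F n in sequentially. inner (z n) u \<le> b" for u b
  proof -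
    obtain N where N: "\<And>n. N \<le> n \<Longrightarrow> inner (z n) u \<le> b"
      using ev unfolding eventually_sequentially by blast
    have "S n \<subseteq> {x. inner u x \<le> b}" if "N \<le> n" for n
      unfolding S_def using N that
      by (intro hull_minimal convex_halfspace_le) (auto simp: inner_commute)
    then have "inner (p n) u \<le> b" if "N \<le> n" for n
      using p(1)[of n] that by (fastforce simp: inner_commute)
    then show ?thesis
      by (intro LIMSEQ_le_const2[OF tendsto_inner[OF q tendsto_const]]) blast
  qed
  then show ?thesis by blast
qed

text \<open>
  The functionals \<open>inner (z n) (q - q')\<close> with \<open>q, q' \<in> Z\<close> converge, and they take their limits as values
  at every point that satisfies all affine inequalities holding eventually along \<open>z\<close>.  Hence two such
  points, which both lie in \<open>Z\<close>, coincide.  If \<open>z\<close> did not converge weakly to that unique point \<open>p\<close>, a subsequence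
  would stay in a half-space away from \<open>p\<close> and supply a second one.
\<close>
lemma opial:
  fixes z :: "nat \<Rightarrow> 'h::{real_inner, complete_space}"
  assumes ne: "Z \<noteq> {}"
    and conv: "\<And>q. q \<in> Z \<Longrightarrow> convergent (\<lambda>n. norm (z n - q))"
    and tail_hulls: "\<And>p. (\<And>u b. \<forall>\<^sub>F n in sequentially. inner (z n) u \<le> b \<Longrightarrow> inner p u \<le> b) \<Longrightarrow> p \<in> Z"
  shows "\<exists>p \<in> Z. converges_weakly z p"
proof -
  define W where "W = {p. \<forall>u b. (\<forall>\<^sub>F n in sequentially. inner (z n) u \<le> b) \<longrightarrow> inner p u \<le> b}"
  have WZ: "p \<in> Z" if "p \<in> W" for p
    using that tail_hulls unfolding W_def by blast
  obtain q where "q \<in> Z" using ne by blast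
  then have "Bseq (\<lambda>n. norm (z n - q))"
    using conv convergent_imp_Bseq by blast
  then obtain M where M: "\<And>n. norm (z n - q) \<le> M"
    unfolding Bseq_def by auto
  have bounded: "norm (z n) \<le> M + norm q" for n
    using M[of n] norm_triangle_sub[of "z n" q] by linarith
  have inner_W: "inner p v = l" if "p \<in> W" "(\<lambda>n. inner (z n) v) \<longlonglongrightarrow> l" for p v l
  proof (rule antisym)
    have le: "inner p v' \<le> l'" if l': "(\<lambda>n. inner (z n) v') \<longlonglongrightarrow> l'" for v' l'
    proof (rule field_le_epsilon)
      fix e :: real assume "0 < e"
      then have "\<forall>\<^sub>F n in sequentially. inner (z n) v' < l' + e"
        using l' by (intro order_tendstoD) auto
      then have "\<forall>\<^sub>F n in sequentially. inner (z n) v' \<le> l' + e"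
        by (rule eventually_mono) simp
      then show "inner p v' \<le> l' + e"
        using \<open>p \<in> W\<close> unfolding W_def by blast
    qed
    show "inner p v \<le> l" using le that by blast
    show "l \<le> inner p v" using le[of "- v" "- l"] that tendsto_minus by force
  qed
  have inner_conv: "convergent (\<lambda>n. inner (z n) (q - q'))" if "q \<in> Z" "q' \<in> Z" for q q'
  proof -
    have eq: "inner (z n) (q - q')
        = ((norm (z n - q'))\<^sup>2 - (norm (z n - q))\<^sup>2 + ((norm q)\<^sup>2 - (norm q')\<^sup>2)) / 2" for n
      by (simp add: power2_norm_eq_inner inner_diff_left inner_diff_right inner_commute)
    obtain l l' where "(\<lambda>n. norm (z n - q)) \<longlonglongrightarrow> l" "(\<lambda>n. norm (z n - q')) \<longlonglongrightarrow> l'"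
      using conv[OF \<open>q \<in> Z\<close>] conv[OF \<open>q' \<in> Z\<close>] unfolding convergent_def by blast
    then have "(\<lambda>n. ((norm (z n - q'))\<^sup>2 - (norm (z n - q))\<^sup>2 + ((norm q)\<^sup>2 - (norm q')\<^sup>2)) / 2)
        \<longlonglongrightarrow> (l'\<^sup>2 - l\<^sup>2 + ((norm q)\<^sup>2 - (norm q')\<^sup>2)) / 2"
      by (intro tendsto_intros) auto
    then show ?thesis
      unfolding eq convergent_def by blast
  qed
  have W_unique: "p = p'" if "p \<in> W" "p' \<in> W" for p p'
  proof -
    obtain l where "(\<lambda>n. inner (z n) (p - p')) \<longlonglongrightarrow> l"
      using inner_conv[OF WZ[OF \<open>p \<in> W\<close>] WZ[OF \<open>p' \<in> W\<close>]] unfolding convergent_def by blast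
    then have "inner (p - p') (p - p') = 0"
      using inner_W that by (simp add: inner_diff_left)
    then show ?thesis by simp
  qed
  have W_subseq: "\<exists>p \<in> W. \<forall>u b. (\<forall>n. inner (z (r n)) u \<le> b) \<longrightarrow> inner p u \<le> b"
    if r: "strict_mono r" for r :: "nat \<Rightarrow> nat"
  proof -
    obtain p where p: "\<And>u b. \<forall>\<^sub>F n in sequentially. inner (z (r n)) u \<le> b \<Longrightarrow> inner p u \<le> b"
      using bounded_seq_has_point_of_tail_hulls[of "\<lambda>n. z (r n)", OF bounded] by blast
    have "p \<in> W"
      unfolding W_def using p eventually_subseq[OF r] by blast
    with p show ?thesis by (intro bexI[of _ p]) auto
  qed
  obtain p where p: "p \<in> W"
    using W_subseq[OF strict_mono_id] by blast
  have upper: "\<forall>\<^sub>F n in sequentially. inner (z n) u < inner p u + e" if e: "0 < e" for u e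
  proof (rule ccontr)
    assume "\<not> ?thesis"
    then have "infinite {n. inner p u + e \<le> inner (z n) u}"
      by (simp add: frequently_cofinite[symmetric] cofinite_eq_sequentially not_eventually not_less)
    then obtain r :: "nat \<Rightarrow> nat" where r: "strict_mono r" "\<And>n. inner p u + e \<le> inner (z (r n)) u"
      using infinite_enumerate by blast
    obtain p' where p': "p' \<in> W" "\<And>v b. (\<And>n. inner (z (r n)) v \<le> b) \<Longrightarrow> inner p' v \<le> b"
      using W_subseq[OF r(1)] by blast
    have "inner p' (- u) \<le> - (inner p u + e)"
      using r(2) by (intro p'(2)) (simp add: algebra_simps)
    then show False
      using W_unique[OF p p'(1)] e by simp
  qed
  have "(\<lambda>n. inner (z n) u) \<longlonglongrightarrow> inner p u" for u
  proof (rule tendstoI)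
    fix e :: real assume "0 < e"
    from upper[OF this, of u] upper[OF this, of "- u"]
    show "\<forall>\<^sub>F n in sequentially. dist (inner (z n) u) (inner p u) < e"
      by eventually_elim (auto simp: dist_real_def)
  qed
  then show ?thesis
    using p WZ unfolding converges_weakly_def by blast
qed

text \<open>
  Adding \<open>1\<close> turns the recursion into \<open>a (Suc n) + 1 \<le> (1 + b n) (a n + 1)\<close>, so \<open>a + 1\<close> divided by the
  convergent partial products \<open>P\<close> is decreasing.
\<close>
lemma convergent_if_summable_perturbation:
  fixes a b :: "nat \<Rightarrow> real"
  assumes a: "\<And>n. 0 \<le> a n" and b: "\<And>n. 0 \<le> b n" "summable b"
    and step: "\<And>n. a (Suc n) \<le> (1 + b n) * a n + b n"
  shows "convergent a"
proof -
  define P where "P = (\<lambda>n. \<Prod>k<n. 1 + b k)"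
  have P_Suc: "P (Suc n) = P n * (1 + b n)" for n by (simp add: P_def)
  have P_pos: "0 < P n" for n
    unfolding P_def using b by (intro prod_pos) (auto intro: add_pos_nonneg)
  have "P n \<le> P (Suc n)" for n
    using P_pos[of n] b(1)[of n] by (simp add: P_Suc algebra_simps)
  then have "incseq P" by (rule incseq_SucI)
  moreover have "P n \<le> exp (suminf b)" for n
  proof -
    have "P n \<le> (\<Prod>k<n. exp (b k))"
      unfolding P_def using b by (intro prod_mono) auto
    also have "\<dots> = exp (sum b {..<n})" by (simp add: exp_sum)
    also have "\<dots> \<le> exp (suminf b)" using b by (simp add: sum_le_suminf)
    finally show ?thesis .
  qed
  ultimately have P: "convergent P"
    using incseq_convergent[of P "exp (suminf b)"] unfolding convergent_def by metis
  define q where "q = (\<lambda>n. (a n + 1) / P n)"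
  have "q (Suc n) \<le> q n" for n
  proof -
    have "a (Suc n) + 1 \<le> (1 + b n) * (a n + 1)"
      using step[of n] by (simp add: algebra_simps)
    then have "q (Suc n) \<le> ((1 + b n) * (a n + 1)) / P (Suc n)"
      unfolding q_def using P_pos by (intro divide_right_mono) (auto simp: less_imp_le)
    also have "\<dots> = q n"
      using b(1)[of n] by (simp add: q_def P_Suc)
    finally show ?thesis .
  qed
  then have "decseq q" by (rule decseq_SucI)
  moreover have "0 \<le> q n" for n
    unfolding q_def using a P_pos by (simp add: less_imp_le)
  ultimately have "convergent q"
    using decseq_convergent[of q 0] unfolding convergent_def by metis
  with P have "convergent (\<lambda>n. q n * P n - 1)"
    by (intro convergent_diff convergent_mult convergent_const)
  moreover have "q n * P n - 1 = a n" for n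
    using P_pos[of n] by (simp add: q_def)
  ultimately show ?thesis by simp
qed

text \<open>
  Any rate \<open>s\<close> strictly above both \<open>r\<close> and \<open>\<eta>\<close> works, with \<open>R\<close> so large that \<open>r R + M \<le> s R\<close>.
\<close>
lemma geometric_bound_if_geometric_perturbation:
  fixes a :: "nat \<Rightarrow> real"
  assumes r: "0 \<le> r" "r < 1" and \<eta>: "0 \<le> \<eta>" "\<eta> < 1" and M: "0 \<le> M"
    and step: "\<And>n. a (Suc n) \<le> r * a n + M * \<eta> ^ n"
  shows "\<exists>R\<ge>0. \<exists>s. 0 < s \<and> s < 1 \<and> (\<forall>n. a n \<le> R * s ^ n)"
proof -
  define s where "s = (1 + max r \<eta>) / 2"
  have s: "0 < s" "s < 1" "r < s" "\<eta> < s" using r \<eta> by (auto simp: s_def)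
  define R where "R = max (max 0 (a 0)) (M / (s - r))"
  have "M \<le> R * (s - r)"
    using s by (simp add: R_def pos_divide_le_eq[symmetric])
  then have R: "r * R + M \<le> R * s" by (simp add: algebra_simps)
  have "a n \<le> R * s ^ n" for n
  proof (induction n)
    case 0
    then show ?case by (simp add: R_def)
  next
    case (Suc n)
    have "a (Suc n) \<le> r * a n + M * \<eta> ^ n" by (rule step)
    also have "\<dots> \<le> r * (R * s ^ n) + M * s ^ n"
      using Suc r s M \<eta> by (intro add_mono mult_left_mono power_mono) auto
    also have "\<dots> = (r * R + M) * s ^ n" by (simp add: algebra_simps)
    also have "\<dots> \<le> R * s * s ^ n"
      using R s by (intro mult_right_mono) auto
    finally show ?case by simp
  qed
  moreover have "0 \<le> R" by (simp add: R_def)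
  ultimately show ?thesis using s by blast
qed

section \<open>The exact step\<close>

text \<open>
  The strict step size condition leaves room for a weight \<open>s\<close> in Young's inequality that is a little
  below \<open>2 \<beta> / \<gamma>\<close>: with \<open>s = 2 \<beta> / \<gamma>\<close> the cocoercivity of \<open>C\<close> would be used up completely, and no
  squared difference of values of \<open>C\<close> would remain in the energy estimate.
\<close>
lemma step_size_margin:
  fixes \<kappa> \<gamma> \<beta> :: real
  assumes "0 < \<beta>" "0 < \<gamma>" "\<kappa>\<^sup>2 * \<gamma>\<^sup>2 * (1 + \<gamma> / (2 * \<beta>)) < 1"
  obtains s \<epsilon> where "0 < s" "0 < \<epsilon>" "\<epsilon> \<le> 1 - \<kappa>\<^sup>2 * \<gamma>\<^sup>2 * (1 + 1 / s)" "\<epsilon> \<le> 2 * \<beta> / \<gamma> - s"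
proof -
  define q where "q = \<kappa>\<^sup>2 * \<gamma>\<^sup>2 * (1 + \<gamma> / (2 * \<beta>))"
  define \<theta> where "\<theta> = (1 + q) / 2"
  have q: "0 \<le> q" "q < 1" using assms by (auto simp: q_def)
  then have \<theta>: "0 < \<theta>" "\<theta> < 1" "q < \<theta>" by (auto simp: \<theta>_def)
  define s where "s = \<theta> * (2 * \<beta> / \<gamma>)"
  have s: "0 < s" "s < 2 * \<beta> / \<gamma>"
    using assms \<theta> mult_strict_right_mono[of \<theta> 1 "2 * \<beta> / \<gamma>"] by (auto simp: s_def)
  have "\<theta> * (\<kappa>\<^sup>2 * \<gamma>\<^sup>2 * (1 + 1 / s)) = \<kappa>\<^sup>2 * \<gamma>\<^sup>2 * (\<theta> + \<gamma> / (2 * \<beta>))"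
    using assms \<theta> by (simp add: s_def field_simps)
  also have "\<dots> \<le> q"
    unfolding q_def using \<theta> by (intro mult_left_mono add_right_mono) auto
  also have "\<dots> < \<theta> * 1" using \<theta> by simp
  finally have "\<kappa>\<^sup>2 * \<gamma>\<^sup>2 * (1 + 1 / s) < 1"
    using \<theta> by (simp only: mult_less_cancel_left_pos)
  with s show thesis
    by (intro that[of s "min (1 - \<kappa>\<^sup>2 * \<gamma>\<^sup>2 * (1 + 1 / s)) (2 * \<beta> / \<gamma> - s)"]) auto
qed

lemma two_inner_le:
  fixes h d :: "'a::real_inner"
  assumes "0 < s"
  shows "2 * inner h d \<le> s * (norm h)\<^sup>2 + (1 / s) * (norm d)\<^sup>2"
proof -
  have "0 \<le> (norm (s *\<^sub>R h - d))\<^sup>2" by simp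
  also have "\<dots> = s * (s * (norm h)\<^sup>2 + (1 / s) * (norm d)\<^sup>2 - 2 * inner h d)"
    using assms unfolding power2_norm_eq_inner
    by (simp add: inner_diff_left inner_diff_right inner_commute algebra_simps)
  finally show ?thesis using assms by (simp add: zero_le_mult_iff)
qed

text \<open>
  For a solution \<open>s\<close> and \<open>p = x - s\<close>, \<open>q = y - s\<close>, \<open>h = \<gamma> (C x - C s)\<close>, \<open>d = \<gamma> (D x - D y)\<close>, the vectors
  \<open>q + h + d\<close> and \<open>p + h\<close> are the differences to \<open>s + \<gamma> C s\<close> after and before the step, and \<open>p - q - h - d\<close> is \<open>\<gamma>\<close> times the
  difference of elements of \<open>A + D\<close> at \<open>y\<close> and \<open>s\<close>.
\<close>
lemma energy_identity:
  fixes p q h d :: "'a::real_inner"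
  shows "(norm (q + h + d))\<^sup>2 = (norm (p + h))\<^sup>2 - (norm (p - q))\<^sup>2 + (norm d)\<^sup>2 + 2 * inner h d
     - 2 * inner p h - 2 * inner q (p - q - h - d)"
  unfolding power2_norm_eq_inner
  by (simp add: inner_add_left inner_add_right inner_diff_left inner_diff_right inner_commute)

text \<open>
  The exact step depends on \<open>K\<close>, \<open>L\<close> and \<open>B\<close> only through the Lipschitz operator \<open>D\<close> and the
  constant \<open>\<sigma>\<close> for which \<open>A + D\<close> is \<open>\<sigma>\<close>-monotone.  Here \<open>A\<close> itself may have a
  negative constant \<open>\<rho>\<close>.
\<close>
locale splitting =
  fixes A :: "'h::{real_inner, complete_space} \<Rightarrow> 'h set" and C D :: "'h \<Rightarrow> 'h"
    and \<rho> \<beta> \<kappa> \<sigma> \<gamma> :: real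
  assumes A: "max_rho_monotone \<rho> A"
    and \<beta>: "0 < \<beta>" and cocoercive: "cocoercive \<beta> C"
    and D_lip: "\<kappa>-lipschitz_on UNIV D"
    and \<sigma>: "0 \<le> \<sigma>"
    and sum_monotone: "\<And>x y u v. u \<in> A x \<Longrightarrow> v \<in> A y \<Longrightarrow>
      \<sigma> * (norm (x - y))\<^sup>2 \<le> inner (x - y) ((u + D x) - (v + D y))"
    and \<gamma>: "0 < \<gamma>" "- 1 < \<rho> * \<gamma>"
    and step: "\<kappa>\<^sup>2 * \<gamma>\<^sup>2 * (1 + \<gamma> / (2 * \<beta>)) < 1"
begin

definition J where "J = resolvent (scale_op \<gamma> (single C))"
definition T where "T = R_op A C D \<gamma>"
definition V where "V = V_op A C D \<gamma>"
definition sols where "sols = {x. - C x - D x \<in> A x}"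
text \<open>
  The inverse of \<open>J\<close>.  It sends a solution to a fixed point of \<open>V\<close>, so distances of the
  iterates are measured to \<open>lift s\<close>.
\<close>
abbreviation lift :: "'h \<Rightarrow> 'h" where "lift x \<equiv> x + \<gamma> *\<^sub>R C x"

lemma C_cocoercive: "\<beta> * (norm (C x - C y))\<^sup>2 \<le> inner (x - y) (C x - C y)"
  using cocoercive by (simp add: cocoercive_def)

lemma C_monotone: "0 \<le> inner (x - y) (C x - C y)"
  using C_cocoercive[of x y] \<beta> by (intro order_trans[OF _ C_cocoercive]) simp

lemma C_lipschitz: "(1 / \<beta>)-lipschitz_on UNIV C"
proof (rule lipschitz_onI)
  show "dist (C x) (C y) \<le> 1 / \<beta> * dist x y" for x y
  proof (cases "C x = C y")
    case False
    have "\<beta> * (norm (C x - C y))\<^sup>2 \<le> norm (x - y) * norm (C x - C y)"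
      using C_cocoercive norm_cauchy_schwarz by (rule order_trans)
    then have "\<beta> * norm (C x - C y) \<le> norm (x - y)"
      using False by (simp add: power2_eq_square)
    then show ?thesis using \<beta> by (simp add: dist_norm field_simps)
  qed (use \<beta> in simp)
qed (use \<beta> in simp)

lemma D_norm: "norm (D x - D y) \<le> \<kappa> * norm (x - y)"
  using lipschitz_onD[OF D_lip, of x y] by (simp add: dist_norm)

lemma \<kappa>_nonneg: "0 \<le> \<kappa>"
  using D_lip by (rule lipschitz_on_nonneg)

lemma C_max_monotone: "max_rho_monotone 0 (single C)"
  using C_lipschitz C_monotone by (rule lipschitz_monotone_imp_max_rho_monotone)

lemma lift_J: "lift (J z) = z"
  using resolventE[OF C_max_monotone \<gamma>(1), of z] by (auto simp: J_def single_def)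

lemma J_lift: "J (lift x) = x"
  unfolding J_def by (rule resolvent_eqI[OF C_max_monotone \<gamma>(1)]) (auto simp: single_def)

lemma J_nonexpansive: "norm (J z - J z') \<le> norm (z - z')"
  using resolvent_lipschitz[OF C_max_monotone \<gamma>(1), of z z'] by (simp add: J_def)

lemma T_eq: "T z = resolvent (scale_op \<gamma> A) (2 *\<^sub>R J z - z - \<gamma> *\<^sub>R D (J z))"
  by (simp add: T_def R_op_def J_def Let_def)

lemma V_eq: "V z = (T z - \<gamma> *\<^sub>R D (T z)) + z - (J z - \<gamma> *\<^sub>R D (J z))"
  by (simp add: V_def V_op_def J_def T_def Let_def)

lemma T_inclusion:
  "\<exists>a \<in> A (T z). \<gamma> *\<^sub>R a = J z - \<gamma> *\<^sub>R C (J z) - \<gamma> *\<^sub>R D (J z) - T z"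
proof -
  obtain a where a: "a \<in> A (T z)" "T z + \<gamma> *\<^sub>R a = 2 *\<^sub>R J z - z - \<gamma> *\<^sub>R D (J z)"
    unfolding T_eq by (rule resolventE[OF A \<gamma>])
  have "\<gamma> *\<^sub>R a = 2 *\<^sub>R J z - z - \<gamma> *\<^sub>R D (J z) - T z"
    using a(2) by (metis add_diff_cancel_left')
  also have "\<dots> = 2 *\<^sub>R J z - lift (J z) - \<gamma> *\<^sub>R D (J z) - T z"
    by (simp only: lift_J)
  finally show ?thesis using a(1) by (intro bexI[of _ a]) (auto simp: scaleR_2)
qed

lemma T_lift: "x \<in> sols \<Longrightarrow> T (lift x) = x"
  unfolding T_eq J_lift
  by (rule resolvent_eqI[OF A \<gamma>, of "- C x - D x"])
    (auto simp: sols_def scaleR_2 algebra_simps)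

lemma V_lift: "x \<in> sols \<Longrightarrow> V (lift x) = lift x"
  by (simp add: V_eq T_lift J_lift)

text \<open>
  In \<open>energy_identity\<close> monotonicity of \<open>A + D\<close> bounds the last term, cocoercivity bounds \<open>- 2 inner p h\<close>, and
  Young's inequality splits \<open>2 inner h d\<close>; the Lipschitz bound \<open>\<parallel>d\<parallel> \<le> \<gamma> \<kappa> \<parallel>p - q\<parallel>\<close> then lets
  \<open>- \<parallel>p - q\<parallel>\<^sup>2\<close> absorb what is left.
\<close>
lemma energy_decrease:
  obtains \<epsilon> where "0 < \<epsilon>"
    "\<And>x z. x \<in> sols \<Longrightarrow> (norm (V z - lift x))\<^sup>2 \<le> (norm (z - lift x))\<^sup>2
      - \<epsilon> * ((norm (J z - T z))\<^sup>2 + (norm (\<gamma> *\<^sub>R (C (J z) - C x)))\<^sup>2)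
      - 2 * \<gamma> * \<sigma> * (norm (T z - x))\<^sup>2"
proof -
  obtain s \<epsilon> where s: "0 < s" and \<epsilon>: "0 < \<epsilon>" "\<epsilon> \<le> 1 - \<kappa>\<^sup>2 * \<gamma>\<^sup>2 * (1 + 1 / s)" "\<epsilon> \<le> 2 * \<beta> / \<gamma> - s"
    using step_size_margin[OF \<beta> \<gamma>(1) step] by blast
  show thesis
  proof (rule that[OF \<epsilon>(1)])
    fix x z assume x: "x \<in> sols"
    define p where "p = J z - x"
    define q where "q = T z - x"
    define h where "h = \<gamma> *\<^sub>R (C (J z) - C x)"
    define d where "d = \<gamma> *\<^sub>R (D (J z) - D (T z))"
    have V: "V z - lift x = q + h + d"
      unfolding V_eq by (subst (2) lift_J[symmetric]) (simp add: q_def h_def d_def algebra_simps)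
    have z: "z - lift x = p + h"
      by (subst lift_J[symmetric]) (simp add: p_def h_def algebra_simps)
    have pq: "p - q = J z - T z" by (simp add: p_def q_def)
    obtain a where a: "a \<in> A (T z)" "\<gamma> *\<^sub>R a = J z - \<gamma> *\<^sub>R C (J z) - \<gamma> *\<^sub>R D (J z) - T z"
      using T_inclusion by blast
    have "\<sigma> * (norm q)\<^sup>2 \<le> inner q ((a + D (T z)) - ((- C x - D x) + D x))"
      unfolding q_def using a(1) x by (intro sum_monotone) (auto simp: sols_def)
    then have "\<gamma> * (\<sigma> * (norm q)\<^sup>2) \<le> \<gamma> * inner q (a + D (T z) + C x)"
      using \<gamma> by simp
    also have "\<dots> = inner q (\<gamma> *\<^sub>R a + \<gamma> *\<^sub>R (D (T z) + C x))"
      by (simp add: inner_add_right algebra_simps)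
    also have "\<gamma> *\<^sub>R a + \<gamma> *\<^sub>R (D (T z) + C x) = p - q - h - d"
      unfolding a(2) pq by (simp add: h_def d_def algebra_simps)
    finally have mono: "\<gamma> * (\<sigma> * (norm q)\<^sup>2) \<le> inner q (p - q - h - d)" .
    have "\<beta> * (norm (C (J z) - C x))\<^sup>2 \<le> inner p (C (J z) - C x)"
      unfolding p_def by (rule C_cocoercive)
    then have "\<gamma> * (\<beta> * (norm (C (J z) - C x))\<^sup>2) \<le> inner p h"
      using \<gamma> by (simp add: h_def)
    then have coco: "\<beta> / \<gamma> * (norm h)\<^sup>2 \<le> inner p h"
      using \<gamma> by (simp add: h_def power_mult_distrib power2_eq_square)
    have "norm d \<le> \<gamma> * (\<kappa> * norm (p - q))"
      unfolding d_def pq using D_norm \<gamma> by simp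
    then have "(norm d)\<^sup>2 \<le> (\<gamma> * (\<kappa> * norm (p - q)))\<^sup>2"
      by (intro power_mono) auto
    then have "(1 + 1 / s) * (norm d)\<^sup>2 \<le> (1 + 1 / s) * (\<gamma> * (\<kappa> * norm (p - q)))\<^sup>2"
      using s by (intro mult_left_mono) auto
    also have "\<dots> = (\<kappa>\<^sup>2 * \<gamma>\<^sup>2 * (1 + 1 / s)) * (norm (p - q))\<^sup>2"
      by (simp add: power_mult_distrib algebra_simps)
    also have "\<dots> \<le> (1 - \<epsilon>) * (norm (p - q))\<^sup>2"
      using \<epsilon> by (intro mult_right_mono) auto
    finally have d: "(norm d)\<^sup>2 + 1 / s * (norm d)\<^sup>2 \<le> (norm (p - q))\<^sup>2 - \<epsilon> * (norm (p - q))\<^sup>2"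
      by (simp add: algebra_simps)
    have "(s + \<epsilon>) * (norm h)\<^sup>2 \<le> (2 * \<beta> / \<gamma>) * (norm h)\<^sup>2"
      using \<epsilon> by (intro mult_right_mono) auto
    then have h: "s * (norm h)\<^sup>2 + \<epsilon> * (norm h)\<^sup>2 \<le> 2 * (\<beta> / \<gamma> * (norm h)\<^sup>2)"
      by (simp add: algebra_simps)
    have "(norm (q + h + d))\<^sup>2 \<le> (norm (p + h))\<^sup>2 - \<epsilon> * (norm (p - q))\<^sup>2 - \<epsilon> * (norm h)\<^sup>2
        - 2 * (\<gamma> * (\<sigma> * (norm q)\<^sup>2))"
      using energy_identity[of q h d p] two_inner_le[OF s, of h d] mono coco d h by linarith
    then show "(norm (V z - lift x))\<^sup>2 \<le> (norm (z - lift x))\<^sup>2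
      - \<epsilon> * ((norm (J z - T z))\<^sup>2 + (norm (\<gamma> *\<^sub>R (C (J z) - C x)))\<^sup>2)
      - 2 * \<gamma> * \<sigma> * (norm (T z - x))\<^sup>2"
      unfolding V z pq[symmetric] h_def[symmetric] q_def[symmetric] by (simp add: algebra_simps)
  qed
qed

lemma V_quasi_nonexpansive:
  assumes "x \<in> sols" shows "norm (V z - lift x) \<le> norm (z - lift x)"
proof -
  obtain \<epsilon> where \<epsilon>: "0 < \<epsilon>"
    "(norm (V z - lift x))\<^sup>2 \<le> (norm (z - lift x))\<^sup>2
      - \<epsilon> * ((norm (J z - T z))\<^sup>2 + (norm (\<gamma> *\<^sub>R (C (J z) - C x)))\<^sup>2)
      - 2 * \<gamma> * \<sigma> * (norm (T z - x))\<^sup>2"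
    using energy_decrease assms by metis
  have "0 \<le> \<epsilon> * ((norm (J z - T z))\<^sup>2 + (norm (\<gamma> *\<^sub>R (C (J z) - C x)))\<^sup>2)"
    "0 \<le> 2 * \<gamma> * \<sigma> * (norm (T z - x))\<^sup>2"
    using \<epsilon>(1) \<gamma> \<sigma> by (auto intro!: mult_nonneg_nonneg add_nonneg_nonneg)
  then have "(norm (V z - lift x))\<^sup>2 \<le> (norm (z - lift x))\<^sup>2"
    using \<epsilon>(2) by linarith
  then show ?thesis by (rule power2_le_imp_le) simp
qed

text \<open>
  The three quantities that \<open>energy_decrease\<close> subtracts bound \<open>\<parallel>z - lift x\<parallel>\<^sup>2\<close>, since
  \<open>z - lift x\<close> is the sum of the three vectors whose norms occur there.
\<close>
lemma V_quasi_contraction: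
  assumes "0 < \<sigma>"
  obtains r where "0 \<le> r" "r < 1"
    "\<And>x z. x \<in> sols \<Longrightarrow> norm (V z - lift x) \<le> r * norm (z - lift x)"
proof -
  obtain \<epsilon> where \<epsilon>: "0 < \<epsilon>"
    "\<And>x z. x \<in> sols \<Longrightarrow> (norm (V z - lift x))\<^sup>2 \<le> (norm (z - lift x))\<^sup>2
      - \<epsilon> * ((norm (J z - T z))\<^sup>2 + (norm (\<gamma> *\<^sub>R (C (J z) - C x)))\<^sup>2)
      - 2 * \<gamma> * \<sigma> * (norm (T z - x))\<^sup>2"
    using energy_decrease by blast
  define m where "m = min 1 (min \<epsilon> (2 * \<gamma> * \<sigma>))"
  have m: "0 < m" "m \<le> 1" "m \<le> \<epsilon>" "m \<le> 2 * \<gamma> * \<sigma>" using \<epsilon>(1) \<gamma> assms by (auto simp: m_def)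
  show thesis
  proof (rule that[of "sqrt (1 - m / 3)"])
    fix x z assume x: "x \<in> sols"
    define a where "a = J z - T z"
    define b where "b = \<gamma> *\<^sub>R (C (J z) - C x)"
    define e where "e = T z - x"
    have "z - lift x = a + b + e"
      by (subst lift_J[symmetric]) (simp add: a_def b_def e_def algebra_simps)
    then have "(norm (z - lift x))\<^sup>2 \<le> (norm a + norm b + norm e)\<^sup>2"
      by (intro power_mono) (auto intro!: norm_triangle_le add_mono norm_triangle_ineq)
    also have "\<dots> \<le> 3 * ((norm a)\<^sup>2 + (norm b)\<^sup>2 + (norm e)\<^sup>2)"
    proof -
      have "0 \<le> (norm a - norm b)\<^sup>2" "0 \<le> (norm a - norm e)\<^sup>2" "0 \<le> (norm b - norm e)\<^sup>2" by auto
      then show ?thesis by (simp add: power2_eq_square algebra_simps)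
    qed
    finally have "m / 3 * (norm (z - lift x))\<^sup>2 \<le> m / 3 * (3 * ((norm a)\<^sup>2 + (norm b)\<^sup>2 + (norm e)\<^sup>2))"
      using m by (intro mult_left_mono) auto
    also have "\<dots> = m * ((norm a)\<^sup>2 + (norm b)\<^sup>2) + m * (norm e)\<^sup>2"
      by (simp add: algebra_simps)
    also have "\<dots> \<le> \<epsilon> * ((norm a)\<^sup>2 + (norm b)\<^sup>2) + 2 * \<gamma> * \<sigma> * (norm e)\<^sup>2"
      using m by (intro add_mono mult_right_mono) auto
    finally have "(norm (V z - lift x))\<^sup>2 \<le> (1 - m / 3) * (norm (z - lift x))\<^sup>2"
      using \<epsilon>(2)[OF x, of z] unfolding a_def b_def e_def by (simp add: algebra_simps)
    then have "sqrt ((norm (V z - lift x))\<^sup>2) \<le> sqrt ((1 - m / 3) * (norm (z - lift x))\<^sup>2)"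
      by (rule real_sqrt_le_mono)
    then show "norm (V z - lift x) \<le> sqrt (1 - m / 3) * norm (z - lift x)"
      by (simp add: real_sqrt_mult)
  qed (use m in auto)
qed

lemma sols_unique:
  assumes "0 < \<sigma>" "x \<in> sols" "x' \<in> sols"
  shows "x = x'"
proof -
  have "\<sigma> * (norm (x - x'))\<^sup>2 \<le> inner (x - x') (((- C x - D x) + D x) - ((- C x' - D x') + D x'))"
    using assms by (intro sum_monotone) (auto simp: sols_def)
  also have "\<dots> = - inner (x - x') (C x - C x')"
    by (simp add: inner_diff_right)
  also have "\<dots> \<le> 0" using C_monotone by simp
  finally show ?thesis using assms(1) by (simp add: mult_le_0_iff)
qed

end

section \<open>The inexact iteration\<close>

text \<open>
  In the step of index \<open>n\<close> the operator \<open>D\<close> is replaced by \<open>Dn n\<close>.  The error grows with the argument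
  because \<open>Dn n - D\<close> comes from a linear map applied to an operator of linear growth.
\<close>
locale inexact_splitting = splitting A C D \<rho> \<beta> \<kappa> \<sigma> \<gamma>
  for A :: "'h::{real_inner, complete_space} \<Rightarrow> 'h set" and C D \<rho> \<beta> \<kappa> \<sigma> \<gamma> +
  fixes Dn :: "nat \<Rightarrow> 'h \<Rightarrow> 'h" and e :: "nat \<Rightarrow> real" and x y z :: "nat \<Rightarrow> 'h"
  assumes e_nonneg: "\<And>n. 0 \<le> e n" and e_summable: "summable e"
    and Dn: "\<And>n u. norm (Dn n u - D u) \<le> e n * (1 + norm u)"
    and x: "\<And>n. x n = J (z n)"
    and y: "\<And>n. y n = resolvent (scale_op \<gamma> A) (2 *\<^sub>R x n - z n - \<gamma> *\<^sub>R Dn n (x n))"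
    and z_Suc: "\<And>n. z (Suc n) = z n + y n - x n - \<gamma> *\<^sub>R (Dn n (y n) - Dn n (x n))"
begin

text \<open>
  The error of \<open>Dn n\<close> enters at \<open>x n\<close>, at \<open>y n\<close>, and through the difference between \<open>y n\<close> and the exact
  \<open>T (z n)\<close>.  All three arguments are at a distance from \<open>s\<close> that is at most proportional to
  \<open>1 + \<parallel>z n - lift s\<parallel>\<close>, since \<open>J\<close>, \<open>D\<close> and the resolvent of \<open>A\<close> are Lipschitz continuous.
\<close>
lemma step_deviation:
  assumes s: "s \<in> sols"
  obtains M where "0 \<le> M"
    "\<And>n. norm (z (Suc n) - V (z n)) \<le> M * e n * (1 + norm (z n - lift s))"
proof -
  define j where "j = 1 / (1 + \<rho> * \<gamma>)"
  have j: "0 < j" using \<gamma> by (simp add: j_def)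
  define E where "E = suminf e"
  have E: "0 \<le> e n" "e n \<le> E" for n
    using sum_le_suminf[OF e_summable, of "{n}"] e_nonneg by (auto simp: E_def)
  have E0: "0 \<le> E" using E[of 0] by simp
  have res: "norm (resolvent (scale_op \<gamma> A) u - resolvent (scale_op \<gamma> A) v) \<le> j * norm (u - v)" for u v
    using resolvent_lipschitz[OF A \<gamma>, of u v] \<gamma> by (simp add: j_def field_simps)
  define g where "g = 1 + norm s"
  have g: "1 \<le> g" by (simp add: g_def)
  have err: "norm (Dn n u - D u) \<le> e n * (g * (1 + norm (u - s)))" for n u
  proof -
    have "1 + norm u \<le> 1 + (norm s + norm (u - s))"
      using norm_triangle_sub[of u s] by simp
    also have "\<dots> \<le> g * (1 + norm (u - s))"
      by (simp add: g_def algebra_simps)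
    finally show ?thesis
      using E(1) by (intro order_trans[OF Dn] mult_left_mono)
  qed
  define k where "k = j * \<gamma> * g"
  define m where "m = j * (3 + \<gamma> * \<kappa>)"
  define M where "M = (1 + \<gamma> * \<kappa>) * k + \<gamma> * g * (1 + k * E + m) + \<gamma> * g"
  have nn: "0 \<le> k" "0 \<le> m" "0 \<le> \<gamma> * \<kappa>" "0 \<le> \<gamma> * g"
    using j \<gamma> g \<kappa>_nonneg by (auto simp: k_def m_def)
  have M: "0 \<le> M"
    using nn E0 by (auto simp: M_def intro!: add_nonneg_nonneg mult_nonneg_nonneg)
  have "norm (z (Suc n) - V (z n)) \<le> M * e n * (1 + norm (z n - lift s))" for n
  proof -
    define a where "a = norm (z n - lift s)"
    have a: "0 \<le> a" by (simp add: a_def)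
    define T' where "T' = T (z n)"
    have xs: "norm (x n - s) \<le> a"
      using J_nonexpansive[of "z n" "lift s"] by (simp add: x a_def J_lift)
    have err_x: "norm (Dn n (x n) - D (x n)) \<le> e n * (g * (1 + a))"
      using xs E(1) g by (intro order_trans[OF err] mult_left_mono add_left_mono) auto
    have "norm (y n - T') \<le> j * norm (\<gamma> *\<^sub>R (D (x n) - Dn n (x n)))"
      unfolding y T'_def T_eq x[symmetric]
      by (rule order_trans[OF res]) (simp add: algebra_simps)
    also have "\<dots> = j * (\<gamma> * norm (Dn n (x n) - D (x n)))"
      using \<gamma> by (simp add: norm_minus_commute)
    also have "\<dots> \<le> j * (\<gamma> * (e n * (g * (1 + a))))"
      using err_x j \<gamma> by (intro mult_left_mono) auto
    finally have yT: "norm (y n - T') \<le> k * (e n * (1 + a))"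
      by (simp add: k_def algebra_simps)
    have Ts: "norm (T' - s) \<le> m * a"
    proof -
      have "norm (T' - s) = norm (T (z n) - T (lift s))"
        by (simp add: T'_def T_lift[OF s])
      also have "\<dots> \<le> j * norm ((2 *\<^sub>R x n - z n - \<gamma> *\<^sub>R D (x n)) - (2 *\<^sub>R s - lift s - \<gamma> *\<^sub>R D s))"
        unfolding T_eq J_lift x[symmetric] by (rule res)
      also have "(2 *\<^sub>R x n - z n - \<gamma> *\<^sub>R D (x n)) - (2 *\<^sub>R s - lift s - \<gamma> *\<^sub>R D s)
          = 2 *\<^sub>R (x n - s) - (z n - lift s) - \<gamma> *\<^sub>R (D (x n) - D s)"
        by (simp add: algebra_simps)
      also have "norm \<dots> \<le> norm (2 *\<^sub>R (x n - s)) + norm (z n - lift s) + norm (\<gamma> *\<^sub>R (D (x n) - D s))"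
        by (intro order_trans[OF norm_triangle_ineq4] add_mono norm_triangle_ineq4 order_refl)
      also have "\<dots> \<le> 2 * a + a + \<gamma> * (\<kappa> * a)"
        using xs \<gamma> \<kappa>_nonneg
        by (intro add_mono)
          (auto simp: a_def intro!: order_trans[OF D_norm] mult_left_mono)
      finally show ?thesis
        using j by (simp add: m_def algebra_simps)
    qed
    have "norm (y n - s) \<le> norm (y n - T') + norm (T' - s)"
      using norm_triangle_ineq[of "y n - T'" "T' - s"] by simp
    also have "\<dots> \<le> k * (E * (1 + a)) + m * (1 + a)"
      using yT Ts nn a E
      by (intro add_mono order_trans[OF yT] order_trans[OF Ts] mult_left_mono mult_right_mono) auto
    finally have "1 + norm (y n - s) \<le> (1 + k * E + m) * (1 + a)"
      using a by (simp add: algebra_simps)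
    then have err_y: "norm (Dn n (y n) - D (y n)) \<le> e n * (g * ((1 + k * E + m) * (1 + a)))"
      using E(1) g by (intro order_trans[OF err] mult_left_mono) auto
    have "z (Suc n) - V (z n) = (y n - T') - \<gamma> *\<^sub>R (D (y n) - D T')
        - \<gamma> *\<^sub>R (Dn n (y n) - D (y n)) + \<gamma> *\<^sub>R (Dn n (x n) - D (x n))"
      unfolding z_Suc V_eq x[symmetric] T'_def[symmetric] by (simp add: algebra_simps)
    also have "norm \<dots> \<le> norm (y n - T') + norm (\<gamma> *\<^sub>R (D (y n) - D T'))
        + norm (\<gamma> *\<^sub>R (Dn n (y n) - D (y n))) + norm (\<gamma> *\<^sub>R (Dn n (x n) - D (x n)))"
      by (intro order_trans[OF norm_triangle_ineq] order_trans[OF norm_triangle_ineq4] add_mono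
          norm_triangle_ineq4 order_refl)
    also have "\<dots> \<le> k * (e n * (1 + a)) + \<gamma> * (\<kappa> * (k * (e n * (1 + a))))
        + \<gamma> * (e n * (g * ((1 + k * E + m) * (1 + a)))) + \<gamma> * (e n * (g * (1 + a)))"
      using yT err_x err_y \<gamma> \<kappa>_nonneg
      by (intro add_mono) (auto intro!: mult_left_mono order_trans[OF D_norm])
    also have "\<dots> = M * e n * (1 + a)"
      by (simp add: M_def algebra_simps)
    finally show ?thesis by (simp add: a_def)
  qed
  with M show thesis by (rule that)
qed

text \<open>
  The second claim holds because \<open>\<parallel>V (z n) - lift s\<parallel>\<close> is squeezed between \<open>\<parallel>z (Suc n) - lift s\<parallel>\<close>, up
  to the deviation, and \<open>\<parallel>z n - lift s\<parallel>\<close>.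
\<close>
lemma distance_convergent:
  assumes s: "s \<in> sols"
  shows "convergent (\<lambda>n. norm (z n - lift s))"
    and "(\<lambda>n. norm (z n - lift s) - norm (V (z n) - lift s)) \<longlonglongrightarrow> 0"
proof -
  obtain M where M: "0 \<le> M"
    "\<And>n. norm (z (Suc n) - V (z n)) \<le> M * e n * (1 + norm (z n - lift s))"
    using step_deviation[OF s] by blast
  let ?a = "\<lambda>n. norm (z n - lift s)"
  have dev: "?a (Suc n) \<le> norm (V (z n) - lift s) + M * e n * (1 + ?a n)" for n
    using M(2)[of n] dist_triangle[of "z (Suc n)" "lift s" "V (z n)"] unfolding dist_norm by linarith
  have "?a (Suc n) \<le> (1 + M * e n) * ?a n + M * e n" for n
    using dev[of n] V_quasi_nonexpansive[OF s, of "z n"] by (simp add: algebra_simps)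
  then show conv: "convergent ?a"
    using M e_nonneg e_summable
    by (intro convergent_if_summable_perturbation[of _ "\<lambda>n. M * e n"]) (auto intro: summable_mult)
  then obtain l where l: "?a \<longlonglongrightarrow> l" by (auto simp: convergent_def)
  have e0: "e \<longlonglongrightarrow> 0" using e_summable by (rule summable_LIMSEQ_zero)
  show "(\<lambda>n. ?a n - norm (V (z n) - lift s)) \<longlonglongrightarrow> 0"
  proof (rule tendsto_sandwich)
    show "\<forall>\<^sub>F n in sequentially. 0 \<le> ?a n - norm (V (z n) - lift s)"
      using V_quasi_nonexpansive[OF s] by simp
    show "\<forall>\<^sub>F n in sequentially. ?a n - norm (V (z n) - lift s) \<le> ?a n - ?a (Suc n) + M * e n * (1 + ?a n)"
      using dev by (intro always_eventually allI) (simp add: algebra_simps)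
    have "(\<lambda>n. ?a n - ?a (Suc n) + M * e n * (1 + ?a n)) \<longlonglongrightarrow> l - l + M * 0 * (1 + l)"
      by (intro tendsto_intros l e0 LIMSEQ_Suc[OF l])
    then show "(\<lambda>n. ?a n - ?a (Suc n) + M * e n * (1 + ?a n)) \<longlonglongrightarrow> 0" by simp
  qed simp
qed

lemma residuals_vanish:
  assumes s: "s \<in> sols"
  shows "(\<lambda>n. J (z n) - T (z n)) \<longlonglongrightarrow> 0" and "(\<lambda>n. C (J (z n))) \<longlonglongrightarrow> C s"
proof -
  obtain \<epsilon> where \<epsilon>: "0 < \<epsilon>"
    "\<And>n. (norm (V (z n) - lift s))\<^sup>2 \<le> (norm (z n - lift s))\<^sup>2
      - \<epsilon> * ((norm (J (z n) - T (z n)))\<^sup>2 + (norm (\<gamma> *\<^sub>R (C (J (z n)) - C s)))\<^sup>2)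
      - 2 * \<gamma> * \<sigma> * (norm (T (z n) - s))\<^sup>2"
    using energy_decrease s by metis
  define a where "a = (\<lambda>n. norm (z n - lift s))"
  define b where "b = (\<lambda>n. norm (V (z n) - lift s))"
  define r where "r = (\<lambda>n. ((a n)\<^sup>2 - (b n)\<^sup>2) / \<epsilon>)"
  obtain l where l: "a \<longlonglongrightarrow> l"
    using distance_convergent(1)[OF s] by (auto simp: convergent_def a_def)
  have ab: "(\<lambda>n. a n - b n) \<longlonglongrightarrow> 0"
    using distance_convergent(2)[OF s] by (simp add: a_def b_def)
  have "b \<longlonglongrightarrow> l"
    using tendsto_diff[OF l ab] by simp
  then have "r \<longlonglongrightarrow> (l\<^sup>2 - l\<^sup>2) / \<epsilon>"
    unfolding r_def using l \<epsilon>(1) by (intro tendsto_intros) auto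
  then have r: "r \<longlonglongrightarrow> 0" by simp
  have sq: "f \<longlonglongrightarrow> 0" if f: "\<And>n. (norm (f n))\<^sup>2 \<le> r n" for f :: "nat \<Rightarrow> 'h"
  proof -
    have "(\<lambda>n. (norm (f n))\<^sup>2) \<longlonglongrightarrow> 0"
      using f by (intro tendsto_sandwich[OF _ _ tendsto_const r]) auto
    then have "(\<lambda>n. sqrt ((norm (f n))\<^sup>2)) \<longlonglongrightarrow> sqrt 0"
      by (rule tendsto_real_sqrt)
    then show ?thesis by (simp add: tendsto_norm_zero_iff)
  qed
  have sum: "(norm (J (z n) - T (z n)))\<^sup>2 + (norm (\<gamma> *\<^sub>R (C (J (z n)) - C s)))\<^sup>2 \<le> r n" for n
  proof -
    have "0 \<le> 2 * \<gamma> * \<sigma> * (norm (T (z n) - s))\<^sup>2" using \<gamma> \<sigma> by simp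
    then show ?thesis
      using \<epsilon>(2)[of n] unfolding r_def a_def b_def pos_le_divide_eq[OF \<epsilon>(1)] mult.commute[of _ \<epsilon>]
      by linarith
  qed
  show "(\<lambda>n. J (z n) - T (z n)) \<longlonglongrightarrow> 0"
    using sum by (intro sq) (meson le_add_same_cancel1 order_trans zero_le_power2)
  have "(\<lambda>n. \<gamma> *\<^sub>R (C (J (z n)) - C s)) \<longlonglongrightarrow> 0"
    using sum by (intro sq) (meson le_add_same_cancel2 order_trans zero_le_power2)
  from tendsto_scaleR[OF tendsto_const[of "1 / \<gamma>"] this]
  have "(\<lambda>n. C (J (z n)) - C s) \<longlonglongrightarrow> 0" using \<gamma> by simp
  then show "(\<lambda>n. C (J (z n))) \<longlonglongrightarrow> C s" by (rule LIM_zero_cancel)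
qed

text \<open>
  The inclusion that defines \<open>T\<close> provides elements \<open>r n\<close> of \<open>(A + D + C) (T (z n))\<close> with \<open>r \<longlonglongrightarrow> 0\<close>.
  Monotonicity against an element \<open>u\<close> of \<open>(A + D + C) v\<close> gives, up to a null sequence, an
  upper bound for \<open>inner (z n) u\<close>, which \<open>p\<close> inherits.  So \<open>q = p - \<gamma> c\<close>, where \<open>c\<close> is the limit of
  \<open>C (J (z n))\<close>, is monotonically related to the graph of \<open>A + D + C\<close> with value \<open>0\<close>, and therefore a
  solution.  Applying \<open>residuals_vanish\<close> to \<open>q\<close> itself shows \<open>C q = c\<close>, hence \<open>p = lift q\<close>.
\<close>
lemma tail_hull_point_in_sols:
  assumes s: "s \<in> sols"
    and p: "\<And>u b. \<forall>\<^sub>F n in sequentially. inner (z n) u \<le> b \<Longrightarrow> inner p u \<le> b"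
  shows "p \<in> lift ` sols"
proof -
  define c where "c = C s"
  define q where "q = p - \<gamma> *\<^sub>R c"
  have JT: "(\<lambda>n. J (z n) - T (z n)) \<longlonglongrightarrow> 0" and CJ: "(\<lambda>n. C (J (z n))) \<longlonglongrightarrow> c"
    using residuals_vanish[OF s] by (simp_all add: c_def)
  define F where "F = (\<lambda>u. C u + D u)"
  have F: "(1 / \<beta> + \<kappa>)-lipschitz_on UNIV F"
    unfolding F_def using C_lipschitz D_lip by (rule lipschitz_on_add)
  define a where "a = (\<lambda>n. SOME a. a \<in> A (T (z n)) \<and>
    \<gamma> *\<^sub>R a = J (z n) - \<gamma> *\<^sub>R C (J (z n)) - \<gamma> *\<^sub>R D (J (z n)) - T (z n))"
  have a: "a n \<in> A (T (z n))"
    "\<gamma> *\<^sub>R a n = J (z n) - \<gamma> *\<^sub>R C (J (z n)) - \<gamma> *\<^sub>R D (J (z n)) - T (z n)" for n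
    unfolding a_def using someI_ex[OF T_inclusion[of "z n", unfolded Bex_def]] by auto
  define r where "r = (\<lambda>n. a n + F (T (z n)))"
  have r_eq: "r n = (1 / \<gamma>) *\<^sub>R (J (z n) - T (z n)) - (F (J (z n)) - F (T (z n)))" for n
  proof -
    have "a n = (1 / \<gamma>) *\<^sub>R (\<gamma> *\<^sub>R a n)" using \<gamma> by simp
    also have "\<dots> = (1 / \<gamma>) *\<^sub>R ((J (z n) - T (z n)) - \<gamma> *\<^sub>R F (J (z n)))"
      unfolding a(2) by (simp add: F_def algebra_simps)
    also have "\<dots> = (1 / \<gamma>) *\<^sub>R (J (z n) - T (z n)) - F (J (z n))"
      using \<gamma> by (simp add: scaleR_diff_right)
    finally show ?thesis by (simp add: r_def)
  qed
  have "(\<lambda>n. F (J (z n)) - F (T (z n))) \<longlonglongrightarrow> 0"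
  proof (rule Lim_null_comparison)
    show "\<forall>\<^sub>F n in sequentially. norm (F (J (z n)) - F (T (z n))) \<le> (1 / \<beta> + \<kappa>) * norm (J (z n) - T (z n))"
      using lipschitz_onD[OF F] by (simp add: dist_norm)
    show "(\<lambda>n. (1 / \<beta> + \<kappa>) * norm (J (z n) - T (z n))) \<longlonglongrightarrow> 0"
      using JT by (intro tendsto_mult_right_zero tendsto_norm_zero)
  qed
  then have r0: "r \<longlonglongrightarrow> 0"
    unfolding r_eq[abs_def] using tendsto_diff[OF tendsto_scaleR[OF tendsto_const[of "1 / \<gamma>"] JT]]
    by force
  have "Bseq (\<lambda>n. norm (z n - lift s))"
    using distance_convergent(1)[OF s] by (rule convergent_imp_Bseq)
  have "- F q \<in> A q"
  proof (rule zero_of_monotonically_related[OF A F])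
    fix v b assume b: "b \<in> A v"
    define u where "u = b + F v"
    have mono: "inner (T (z n) - v) u \<le> inner (T (z n) - v) (r n)" for n
    proof -
      have "0 \<le> \<sigma> * (norm (T (z n) - v))\<^sup>2" using \<sigma> by simp
      also have "\<dots> \<le> inner (T (z n) - v) ((a n + D (T (z n))) - (b + D v))"
        using a(1) b by (rule sum_monotone)
      also have "\<dots> \<le> inner (T (z n) - v) ((a n + D (T (z n))) - (b + D v))
          + inner (T (z n) - v) (C (T (z n)) - C v)"
        using C_monotone by simp
      finally show ?thesis
        by (simp add: r_def u_def F_def inner_add_right inner_diff_right)
    qed
    define \<delta> where "\<delta> = (\<lambda>n. inner (T (z n) - v) (r n) + \<gamma> * inner (C (J (z n)) - c) u + inner (J (z n) - T (z n)) u)"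
    have "(\<lambda>n. inner (T (z n) - v) (r n)) \<longlonglongrightarrow> 0"
    proof -
      obtain M where M: "\<And>n. norm (z n - lift s) \<le> M"
        using \<open>Bseq _\<close> unfolding Bseq_def by auto
      have T_bound: "norm (T (z n) - v) \<le> M + norm (s - v) + norm (J (z n) - T (z n))" for n
      proof -
        have "norm (J (z n) - s) \<le> M"
          using J_nonexpansive[of "z n" "lift s"] M[of n] by (simp add: J_lift)
        moreover have "T (z n) - v = (J (z n) - s) + (s - v) - (J (z n) - T (z n))" by simp
        then have "norm (T (z n) - v) \<le> norm (J (z n) - s) + norm (s - v) + norm (J (z n) - T (z n))"
          by (metis (no_types) norm_triangle_ineq4 norm_triangle_ineq add_right_mono order_trans)
        ultimately show ?thesis by simp
      qed
      have bound: "norm (inner (T (z n) - v) (r n))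
          \<le> (M + norm (s - v) + norm (J (z n) - T (z n))) * norm (r n)" for n
        using Cauchy_Schwarz_ineq2[of "T (z n) - v" "r n"] mult_right_mono[OF T_bound[of n], of "norm (r n)"]
        by simp
      have "(\<lambda>n. (M + norm (s - v) + norm (J (z n) - T (z n))) * norm (r n))
          \<longlonglongrightarrow> (M + norm (s - v) + norm (0 :: 'h)) * norm (0 :: 'h)"
        by (intro tendsto_mult tendsto_add tendsto_const tendsto_norm JT r0)
      then have "(\<lambda>n. (M + norm (s - v) + norm (J (z n) - T (z n))) * norm (r n)) \<longlonglongrightarrow> 0"
        by simp
      with always_eventually[OF allI[OF bound]] show ?thesis
        by (rule Lim_null_comparison)
    qed
    then have \<delta>: "\<delta> \<longlonglongrightarrow> 0 + \<gamma> * inner (c - c) u + inner 0 u"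
      unfolding \<delta>_def
      by (intro tendsto_add tendsto_mult tendsto_inner tendsto_diff tendsto_const CJ JT)
    have le: "inner (z n) u \<le> inner (v + \<gamma> *\<^sub>R c) u + \<delta> n" for n
    proof -
      have "inner (z n) u = inner (T (z n) - v) u + \<gamma> * inner (C (J (z n)) - c) u
          + inner (J (z n) - T (z n)) u + inner (v + \<gamma> *\<^sub>R c) u"
        by (subst (1) lift_J[symmetric]) (simp add: inner_add_left inner_diff_left algebra_simps)
      then show ?thesis using mono[of n] by (simp add: \<delta>_def)
    qed
    have "inner p u \<le> inner (v + \<gamma> *\<^sub>R c) u"
    proof (rule field_le_epsilon)
      fix t :: real assume "0 < t"
      then have "\<forall>\<^sub>F n in sequentially. \<delta> n < t"
        using \<delta> by (intro order_tendstoD) auto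
      then have "\<forall>\<^sub>F n in sequentially. inner (z n) u \<le> inner (v + \<gamma> *\<^sub>R c) u + t"
        by eventually_elim (use le in \<open>smt (verit)\<close>)
      then show "inner p u \<le> inner (v + \<gamma> *\<^sub>R c) u + t" by (rule p)
    qed
    then show "0 \<le> inner (v - q) (b + F v)"
      by (simp add: q_def u_def inner_diff_left inner_add_left)
  qed
  then have q: "q \<in> sols" by (simp add: sols_def F_def)
  have "C q = c"
    using residuals_vanish(2)[OF q] CJ by (rule LIMSEQ_unique)
  then have "p = lift q" by (simp add: q_def)
  with q show ?thesis by blast
qed

text \<open>
  Weak convergence passes from \<open>z\<close> to \<open>x n = z n - \<gamma> C (J (z n))\<close> because the
  subtracted term converges strongly.
\<close>
lemma weak_convergence:
  assumes "sols \<noteq> {}"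
  shows "\<exists>s \<in> sols. converges_weakly z (lift s) \<and> converges_weakly x s"
proof -
  obtain s0 where s0: "s0 \<in> sols" using assms by blast
  have "\<exists>p \<in> lift ` sols. converges_weakly z p"
  proof (rule opial)
    show "lift ` sols \<noteq> {}" using assms by simp
    show "convergent (\<lambda>n. norm (z n - q))" if "q \<in> lift ` sols" for q
      using that distance_convergent(1) by auto
    show "p \<in> lift ` sols"
      if "\<And>u b. \<forall>\<^sub>F n in sequentially. inner (z n) u \<le> b \<Longrightarrow> inner p u \<le> b" for p
      using s0 that by (rule tail_hull_point_in_sols)
  qed
  then obtain s where s: "s \<in> sols" "converges_weakly z (lift s)" by blast
  have "(\<lambda>n. inner (x n) u) \<longlonglongrightarrow> inner s u" for u
  proof -
    have w: "(\<lambda>n. inner (z n) u) \<longlonglongrightarrow> inner (lift s) u"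
      using s(2) by (simp only: converges_weakly_def)
    have "(\<lambda>n. inner (z n) u - \<gamma> * inner (C (J (z n))) u) \<longlonglongrightarrow> inner (lift s) u - \<gamma> * inner (C s) u"
      by (intro tendsto_diff[OF w] tendsto_mult tendsto_inner tendsto_const residuals_vanish(2)[OF s(1)])
    moreover have "inner (z n) u - \<gamma> * inner (C (J (z n))) u = inner (x n) u" for n
      by (subst (1) lift_J[symmetric]) (simp add: x inner_add_left)
    ultimately show ?thesis by (simp add: inner_add_left)
  qed
  with s show ?thesis unfolding converges_weakly_def by blast
qed

lemma linear_convergence:
  assumes \<sigma>: "0 < \<sigma>" and s: "s \<in> sols"
    and \<eta>: "0 \<le> \<eta>" "\<eta> < 1" and e: "\<And>n. e n = e0 * \<eta> ^ n"
  shows "converges_linearly z (lift s)" "converges_linearly x s"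
proof -
  obtain r where r: "0 \<le> r" "r < 1" "\<And>z. norm (V z - lift s) \<le> r * norm (z - lift s)"
    using V_quasi_contraction[OF \<sigma>] s by metis
  obtain M where M: "0 \<le> M"
    "\<And>n. norm (z (Suc n) - V (z n)) \<le> M * e n * (1 + norm (z n - lift s))"
    using step_deviation[OF s] by blast
  have "Bseq (\<lambda>n. norm (z n - lift s))"
    using distance_convergent(1)[OF s] by (rule convergent_imp_Bseq)
  then obtain N where N: "0 < N" "\<And>n. norm (z n - lift s) \<le> N"
    unfolding Bseq_def by auto
  have e0: "0 \<le> e0" using e[of 0] e_nonneg[of 0] by simp
  have "norm (z (Suc n) - lift s) \<le> r * norm (z n - lift s) + (M * e0 * (1 + N)) * \<eta> ^ n" for n
  proof -
    have "norm (z (Suc n) - lift s) \<le> norm (V (z n) - lift s) + norm (z (Suc n) - V (z n))"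
      using dist_triangle[of "z (Suc n)" "lift s" "V (z n)"] unfolding dist_norm by linarith
    also have "\<dots> \<le> r * norm (z n - lift s) + M * e n * (1 + N)"
      using M(1) N(2) e_nonneg by (intro add_mono r(3) order_trans[OF M(2)] mult_left_mono) auto
    finally show ?thesis by (simp add: e algebra_simps)
  qed
  then have "\<exists>R\<ge>0. \<exists>t. 0 < t \<and> t < 1 \<and> (\<forall>n. norm (z n - lift s) \<le> R * t ^ n)"
    using M(1) N(1) e0 by (intro geometric_bound_if_geometric_perturbation[OF r(1,2) \<eta>, of "M * e0 * (1 + N)"]) auto
  then obtain R t where Rt: "0 \<le> R" "0 < t" "t < 1" "\<And>n. norm (z n - lift s) \<le> R * t ^ n"
    by blast
  have lin: "converges_linearly f l" if "\<And>n. norm (f n - l) \<le> R * t ^ n" for f and l :: 'h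
    unfolding converges_linearly_def
    by (rule exI[of _ R], rule conjI[OF Rt(1)], rule exI[of _ t]) (simp add: Rt(2,3) that)
  show "converges_linearly z (lift s)"
    using Rt(4) by (rule lin)
  show "converges_linearly x s"
  proof (rule lin)
    show "norm (x n - s) \<le> R * t ^ n" for n
      using J_nonexpansive[of "z n" "lift s"] Rt(4)[of n] by (simp add: x J_lift)
  qed
qed

end

section \<open>The mismatched operators\<close>

lemma lipschitz_on_blinfun: "(norm L)-lipschitz_on UNIV (blinfun_apply L)"
  by (rule lipschitz_onI) (simp_all add: dist_norm blinfun.diff_right[symmetric] norm_blinfun)

lemma lambda_min_le:
  fixes L :: "'h::real_inner \<Rightarrow>\<^sub>L 'g::real_normed_vector"
  shows "lambda_min L K * (norm d)\<^sup>2 \<le> inner d (K (L d))"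
proof (cases "d = 0")
  case False
  let ?Q = "{inner x (K (L x)) |x. norm x = 1}"
  have "bdd_below ?Q"
  proof (rule bdd_belowI[of _ "- (norm K * norm L)"])
    fix r assume "r \<in> ?Q"
    then obtain x where x: "norm x = 1" "r = inner x (K (L x))" by blast
    have "- inner x (K (L x)) \<le> norm x * norm (K (L x))"
      using Cauchy_Schwarz_ineq2[of x "K (L x)"] by linarith
    also have "\<dots> \<le> norm K * norm L"
      using order_trans[OF norm_blinfun[of K "L x"] mult_left_mono[OF norm_blinfun[of L x] norm_ge_zero[of K]]] x
      by simp
    finally show "- (norm K * norm L) \<le> r" by (simp add: x)
  qed
  moreover define e where "e = (1 / norm d) *\<^sub>R d"
  have "norm e = 1" using False by (simp add: e_def)
  ultimately have "lambda_min L K \<le> inner e (K (L e))"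
    unfolding lambda_min_def by (intro cInf_lower) blast+
  also have "\<dots> = inner d (K (L d)) / (norm d)\<^sup>2"
    by (simp add: e_def blinfun.scaleR_right power2_eq_square)
  finally show ?thesis using False by (simp add: field_simps)
qed (simp add: blinfun.zero_right)

lemma zeta_tilde_lipschitz:
  assumes "\<zeta>-lipschitz_on UNIV B"
  shows "(zeta_tilde B L M)-lipschitz_on UNIV (\<lambda>x. M (B (L x)))"
proof -
  have "(\<zeta> * norm L)-lipschitz_on UNIV (\<lambda>x. B (L x))"
    by (intro lipschitz_on_compose2[OF lipschitz_on_blinfun] lipschitz_on_subset[OF assms] subset_UNIV)
  then have "(norm M * (\<zeta> * norm L))-lipschitz_on UNIV (\<lambda>x. M (B (L x)))"
    by (rule lipschitz_on_compose2) (rule lipschitz_on_subset[OF lipschitz_on_blinfun subset_UNIV])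
  then show ?thesis
    unfolding zeta_tilde_def by (rule Lip_lipschitz)
qed

lemma D_op_lipschitz:
  assumes B: "\<zeta>-lipschitz_on UNIV B"
  shows "(kappa \<alpha> B L M)-lipschitz_on UNIV (D_op \<alpha> B c L M)"
proof -
  have "(\<bar>\<alpha>\<bar> * norm L + \<zeta> * norm L)-lipschitz_on UNIV (\<lambda>x. \<alpha> *\<^sub>R L x + B (L x))"
    by (intro lipschitz_on_add lipschitz_on_cmult lipschitz_on_blinfun
      lipschitz_on_compose2[OF lipschitz_on_blinfun] lipschitz_on_subset[OF B] subset_UNIV)
  then have "(norm M * (\<bar>\<alpha>\<bar> * norm L + \<zeta> * norm L))-lipschitz_on UNIV (\<lambda>x. M (\<alpha> *\<^sub>R L x + B (L x)))"
    by (rule lipschitz_on_compose2) (rule lipschitz_on_subset[OF lipschitz_on_blinfun subset_UNIV])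
  then have "(kappa \<alpha> B L M)-lipschitz_on UNIV (\<lambda>x. M (\<alpha> *\<^sub>R L x + B (L x)))"
    unfolding kappa_def by (rule Lip_lipschitz)
  moreover have "D_op \<alpha> B c L M x - D_op \<alpha> B c L M y
      = M (\<alpha> *\<^sub>R L x + B (L x)) - M (\<alpha> *\<^sub>R L y + B (L y))" for x y
    by (simp add: D_op_def blinfun.add_right blinfun.diff_right blinfun.scaleR_right algebra_simps)
  ultimately show ?thesis
    by (simp add: lipschitz_on_def dist_norm)
qed

text \<open>
  With \<open>L\<^sup>*\<close> in place of \<open>K\<close> the term \<open>L\<^sup>* B L\<close> would be monotone.  The mismatch \<open>L\<^sup>* - K\<close>
  costs at most the Lipschitz constant of \<open>(L\<^sup>* - K) B L\<close>, and the linear part \<open>\<alpha> K L\<close> contributes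
  \<open>\<alpha> lambda_min\<close>.
\<close>
lemma rho_hat_monotone:
  fixes A :: "'h::{real_inner, complete_space} \<Rightarrow> 'h set"
    and L :: "'h \<Rightarrow>\<^sub>L 'g::{real_inner, complete_space}"
  assumes A: "max_rho_monotone \<rho> A"
    and B: "rho_monotone 0 (single B)" "\<zeta>-lipschitz_on UNIV B" and \<alpha>: "0 \<le> \<alpha>"
    and uv: "u \<in> A x" "v \<in> A y"
  shows "rho_hat \<rho> \<alpha> B L K * (norm (x - y))\<^sup>2
    \<le> inner (x - y) ((u + D_op \<alpha> B c L K x) - (v + D_op \<alpha> B c L K y))"
proof -
  define d where "d = x - y"
  define b where "b = B (L x) - B (L y)"
  let ?N = "hilbert_adjoint L - K"
  have 1: "\<rho> * (norm d)\<^sup>2 \<le> inner d (u - v)"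
    unfolding d_def using max_rho_monotoneD[OF A uv] .
  have 2: "\<alpha> * (lambda_min L K * (norm d)\<^sup>2) \<le> \<alpha> * inner d (K (L d))"
    using \<alpha> lambda_min_le by (rule mult_left_mono[rotated])
  have "0 \<le> inner (L x - L y) b"
    using B(1) by (fastforce simp: rho_monotone_def gra_def single_def b_def)
  then have 3: "0 \<le> inner d (hilbert_adjoint L b)"
    by (simp add: inner_hilbert_adjoint[symmetric] d_def blinfun.diff_right)
  have "inner d (?N b) \<le> norm d * norm (?N b)"
    by (rule norm_cauchy_schwarz)
  also have "\<dots> \<le> norm d * (zeta_tilde B L ?N * norm d)"
    using lipschitz_onD[OF zeta_tilde_lipschitz[OF B(2), where L = L and M = ?N], of x y]
    by (intro mult_left_mono) (simp_all add: dist_norm b_def d_def blinfun.diff_right)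
  finally have 4: "inner d (?N b) \<le> zeta_tilde B L ?N * (norm d)\<^sup>2"
    by (simp add: power2_eq_square ac_simps)
  have "(u + D_op \<alpha> B c L K x) - (v + D_op \<alpha> B c L K y)
      = (u - v) + \<alpha> *\<^sub>R K (L d) + (hilbert_adjoint L b - ?N b)"
    by (simp add: D_op_def b_def d_def blinfun.diff_right blinfun.diff_left algebra_simps)
  then have "inner d ((u + D_op \<alpha> B c L K x) - (v + D_op \<alpha> B c L K y))
      = inner d (u - v) + \<alpha> * inner d (K (L d)) + (inner d (hilbert_adjoint L b) - inner d (?N b))"
    by (simp only: inner_add_right inner_diff_right[of d "hilbert_adjoint L b"] inner_scaleR_right)
  then show ?thesis
    using 1 2 3 4 unfolding rho_hat_def d_def[symmetric] by (simp add: algebra_simps)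
qed

lemma D_op_perturbation:
  fixes L :: "'h::real_normed_vector \<Rightarrow>\<^sub>L 'g::real_normed_vector"
  assumes B: "\<zeta>-lipschitz_on UNIV B"
  obtains b where "0 \<le> b"
    "\<And>M M' u. norm (D_op \<alpha> B c L M u - D_op \<alpha> B c L M' u) \<le> b * norm (M - M') * (1 + norm u)"
proof -
  define G where "G = (\<lambda>u. \<alpha> *\<^sub>R (L u - c) + B (L u))"
  define l where "l = \<bar>\<alpha>\<bar> * norm L + \<zeta> * norm L"
  define b where "b = l + norm (G 0)"
  have l: "0 \<le> l" using lipschitz_on_nonneg[OF B] by (simp add: l_def)
  have G: "norm (G u) \<le> b * (1 + norm u)" for u
  proof -
    have "norm (B (L u) - B (L 0)) \<le> \<zeta> * (norm L * norm u)"
      using lipschitz_onD[OF B, of "L u" "L 0"] lipschitz_on_nonneg[OF B]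
      by (auto simp: dist_norm blinfun.zero_right intro: order_trans mult_left_mono norm_blinfun)
    moreover have "norm (\<alpha> *\<^sub>R L u) \<le> \<bar>\<alpha>\<bar> * (norm L * norm u)"
      by (auto intro: mult_left_mono norm_blinfun)
    moreover have "G u - G 0 = \<alpha> *\<^sub>R L u + (B (L u) - B (L 0))"
      by (simp add: G_def blinfun.zero_right algebra_simps)
    then have "norm (G u - G 0) \<le> norm (\<alpha> *\<^sub>R L u) + norm (B (L u) - B (L 0))"
      by (simp only: norm_triangle_ineq)
    ultimately have "norm (G u - G 0) \<le> l * norm u"
      by (simp add: l_def algebra_simps)
    then have "norm (G u) \<le> l * norm u + norm (G 0)"
      using norm_triangle_sub[of "G u" "G 0"] by linarith
    also have "\<dots> \<le> b * (1 + norm u)"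
      using l by (simp add: b_def algebra_simps)
    finally show ?thesis .
  qed
  show thesis
  proof (rule that[of b])
    show "0 \<le> b" using l by (simp add: b_def)
    fix M M' :: "'g \<Rightarrow>\<^sub>L 'h" and u
    have "D_op \<alpha> B c L M u - D_op \<alpha> B c L M' u = (M - M') (G u)"
      by (simp add: D_op_def G_def blinfun.diff_left blinfun.add_right blinfun.diff_right blinfun.scaleR_right
          scaleR_diff_right)
    also have "norm \<dots> \<le> norm (M - M') * norm (G u)" by (rule norm_blinfun)
    also have "\<dots> \<le> norm (M - M') * (b * (1 + norm u))"
      using G by (intro mult_left_mono) auto
    finally show "norm (D_op \<alpha> B c L M u - D_op \<alpha> B c L M' u) \<le> b * norm (M - M') * (1 + norm u)"
      by (simp add: ac_simps)
  qed
qed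

text \<open>
  It remains to recognize the data as an instance of the abstract iteration and to translate between
  the set-valued formulations of the problem and \<open>- C x - D x \<in> A x\<close>.
\<close>
theorem theorem5p5:
  fixes A :: "'h::{real_inner, complete_space} \<Rightarrow> 'h set"
    and C :: "'h \<Rightarrow> 'h"
    and B :: "'g::{real_inner, complete_space} \<Rightarrow> 'g"
    and L :: "'h \<Rightarrow>\<^sub>L 'g"
    and K :: "'g \<Rightarrow>\<^sub>L 'h"
    and c :: 'g
    and \<rho> \<beta> \<zeta> \<alpha> \<gamma> :: real
    and Kn :: "nat \<Rightarrow> ('g \<Rightarrow>\<^sub>L 'h)"
    and \<omega> :: "nat \<Rightarrow> real"
    and z0 :: 'h
    and z x w y :: "nat \<Rightarrow> 'h"
  assumes A: "max_rho_monotone \<rho> A"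
    and C: "0 < \<beta>" "cocoercive \<beta> C"
    and B: "rho_monotone 0 (single B)" "0 < \<zeta>" "\<zeta>-lipschitz_on UNIV B"
    and \<alpha>: "0 \<le> \<alpha>"
    and sol: "solutions_P A C \<alpha> B c L K \<noteq> {}"
    and D_nonzero: "D_op \<alpha> B c L K \<noteq> (\<lambda>x. 0)"
    and rho_hat_nonneg: "0 \<le> rho_hat \<rho> \<alpha> B L K"
    and \<omega>_nonneg: "\<And>n. 0 \<le> \<omega> n"
    and \<omega>_summable: "summable \<omega>"
    and Kn: "\<And>n. norm (Kn n - K) \<le> \<omega> n"
    and \<gamma>: "\<gamma> \<in> step_sizes \<rho> \<beta> \<alpha> B L K"
    and z_0: "z 0 = z0"
    and x: "\<And>n. x n = resolvent (scale_op \<gamma> (single C)) (z n)"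
    and w: "\<And>n. w n = D_op \<alpha> B c L (Kn n) (x n)"
    and y: "\<And>n. y n = resolvent (scale_op \<gamma> A) (2 *\<^sub>R x n - z n - \<gamma> *\<^sub>R w n)"
    and z_Suc: "\<And>n. z (Suc n) =
                  z n + y n - x n - \<gamma> *\<^sub>R (D_op \<alpha> B c L (Kn n) (y n) - w n)"
  shows "\<exists>zbar \<in> Fix (V_op A C (D_op \<alpha> B c L K) \<gamma>).
           converges_weakly z zbar \<and>
           converges_weakly x (resolvent (scale_op \<gamma> (single C)) zbar) \<and>
           resolvent (scale_op \<gamma> (single C)) zbar
             \<in> zer (\<lambda>u. A u + {C u} + {D_op \<alpha> B c L K u}) \<and>
           (0 < rho_hat \<rho> \<alpha> B L K \<and> (\<exists>\<eta>. 0 \<le> \<eta> \<and> \<eta> < 1 \<and> (\<forall>n. \<omega> n = \<omega> 0 * \<eta> ^ n)) \<longrightarrow>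
             converges_linearly z zbar \<and>
             converges_linearly x (resolvent (scale_op \<gamma> (single C)) zbar) \<and>
             solutions_P A C \<alpha> B c L K = {resolvent (scale_op \<gamma> (single C)) zbar})"
proof -
  define D where "D = D_op \<alpha> B c L K"
  obtain b where b: "0 \<le> b"
    "\<And>M M' u. norm (D_op \<alpha> B c L M u - D_op \<alpha> B c L M' u) \<le> b * norm (M - M') * (1 + norm u)"
    using D_op_perturbation[OF B(3)] by blast
  have step: "0 < \<gamma>" "- 1 < \<rho> * \<gamma>" "(kappa \<alpha> B L K)\<^sup>2 * \<gamma>\<^sup>2 * (1 + \<gamma> / (2 * \<beta>)) < 1"
    using \<gamma> by (auto simp: step_sizes_def)
  interpret splitting A C D \<rho> \<beta> "kappa \<alpha> B L K" "rho_hat \<rho> \<alpha> B L K" \<gamma>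
  proof
    show "(kappa \<alpha> B L K)-lipschitz_on UNIV D"
      unfolding D_def using B(3) by (rule D_op_lipschitz)
    show "rho_hat \<rho> \<alpha> B L K * (norm (x - y))\<^sup>2 \<le> inner (x - y) (u + D x - (v + D y))"
      if "u \<in> A x" "v \<in> A y" for x y u v
      unfolding D_def using A B(1,3) \<alpha> that by (rule rho_hat_monotone)
  qed (use A C rho_hat_nonneg step in auto)
  interpret inexact_splitting A C D \<rho> \<beta> "kappa \<alpha> B L K" "rho_hat \<rho> \<alpha> B L K" \<gamma>
    "\<lambda>n. D_op \<alpha> B c L (Kn n)" "\<lambda>n. b * \<omega> n" x y z
  proof
    show "norm (D_op \<alpha> B c L (Kn n) u - D u) \<le> b * \<omega> n * (1 + norm u)" for n u
      unfolding D_def using b(1) Kn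
      by (intro order_trans[OF b(2)] mult_right_mono mult_left_mono) auto
  qed (use b(1) \<omega>_nonneg \<omega>_summable x y z_Suc w in \<open>auto simp: J_def intro: summable_mult\<close>)
  have mem: "0 \<in> A u + {C u} + {D u} \<longleftrightarrow> u \<in> sols" for u
  proof -
    have "0 = a + C u + D u \<longleftrightarrow> a = - C u - D u" for a
      unfolding eq_diff_eq eq_neg_iff_add_eq_0 by (auto simp: add_ac)
    then show ?thesis
      unfolding sols_def set_plus_def by auto
  qed
  have set_plus_singletons: "{a} + {b} = {a + b}" for a b :: 'h
    by (simp add: set_plus_def)
  have sols: "solutions_P A C \<alpha> B c L K = sols"
  proof -
    have "S + {C u} + {\<alpha> *\<^sub>R K (L u - c)} + {K (B (L u))} = S + {C u} + {D u}" for S u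
      by (simp add: D_def D_op_def add.assoc set_plus_singletons)
    then show ?thesis
      using mem by (auto simp: solutions_P_def)
  qed
  obtain s where s: "s \<in> sols" "converges_weakly z (lift s)" "converges_weakly x s"
    using weak_convergence sol sols by blast
  have J: "resolvent (scale_op \<gamma> (single C)) (lift s) = s"
    using J_lift by (simp add: J_def)
  show ?thesis
    unfolding D_def[symmetric]
  proof (intro bexI[of _ "lift s"] conjI impI, unfold J)
    show "lift s \<in> Fix (V_op A C D \<gamma>)"
      using V_lift[OF s(1)] by (simp add: Fix_def V_def)
    show "s \<in> zer (\<lambda>u. A u + {C u} + {D u})"
      using s(1) mem by (simp add: zer_def)
    assume lin: "0 < rho_hat \<rho> \<alpha> B L K \<and> (\<exists>\<eta>\<ge>0. \<eta> < 1 \<and> (\<forall>n. \<omega> n = \<omega> 0 * \<eta> ^ n))"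
    then obtain \<eta> where \<eta>: "0 \<le> \<eta>" "\<eta> < 1" "\<And>n. \<omega> n = \<omega> 0 * \<eta> ^ n" by blast
    have e: "b * \<omega> n = (b * \<omega> 0) * \<eta> ^ n" for n
      using \<eta>(3)[of n] by simp
    show "converges_linearly z (lift s)" "converges_linearly x s"
      using linear_convergence[OF _ s(1) \<eta>(1,2) e] lin by auto
    have "s' = s" if "s' \<in> sols" for s'
      using lin that s(1) by (intro sols_unique) auto
    then show "solutions_P A C \<alpha> B c L K = {s}"
      unfolding sols using s(1) by blast
  qed (use s in auto)
qed

end
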